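(* Let $d\geq3$ and let $n=dm$ for some integer $m\geq2$. Then there exists a constant $C>0$, independent of $n$ and $d$, such that $\gamma_{\mathrm{SL}(n)}(\varrho_{n,d})\leq 2^{-Cdm}=2^{-Cn}$. More concretely, for $d=3$ and $m\geq3$, $$\gamma_{\mathrm{SL}(n)}(\varrho_{n,d})\leq\operatorname{dist}(0,\operatorname{conv}(\Gamma_{m,3}))\leq 2^{-m+1}=2^{-\frac n3+1},$$ and if $m\geq3$ and $d=6r-3$ for some $r\geq2$, $$\gamma_{\mathrm{SL}(n)}(\varrho_{n,d})\leq\operatorname{dist}(0,\operatorname{conv}(\Gamma_{m,6r-3}))\leq 2^{-r(m-1)+1}=2^{-\frac{(d+3)(m-1)}{6}+1}.$$
   Context: $\varrho_{n,d}:\mathrm{SL}(n)\to\mathrm{GL}(\mathbb{C}[x_1,\dots,x_n]_d)$ is the representation on homogeneous degree-$d$ polynomials given by $(g\cdot p)(x)=p(g^{-1}x)$. Fix an $\mathrm{SU}(n)$-invariant Hermitian inner product $\langle\cdot,\cdot\rangle$ on $V=\mathbb{C}[x_1,\dots,x_n]_d$ and let $\Pi$ be the induced Lie algebra representation $\Pi(A)=\frac{d}{dt}|_{t=0}\varrho_{n,d}(e^{tA})$. For $v\neq0$, the moment map $\mu(v)$ is the unique traceless Hermitian $n\times n$ matrix with $\operatorname{tr}(\mu(v)A)=\langle v,\Pi(A)v\rangle/\langle v,v\rangle$ for all traceless Hermitian $A$. $v$ is unstable if $0\in\overline{\mathrm{SL}(n)\cdot v}$. The gap is $\gamma_{\mathrm{SL}(n)}(\varrho_{n,d}):=\min\{\|\mu(v)\|_F: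 v\neq0\text{ unstable}\}$. For the concrete bounds: let $\varepsilon_i:=e_i-\frac1m\mathbb{1}_m\in\mathbb{R}^m$. For $N\geq2$ let $\mathfrak{W}_N:=\bigcup_{s=2}^N\{(s,1,s),(s,s,1),(s-1,s,s)\}\subseteq[N]^3$. Let $\Gamma_{m,3}:=\{(\varepsilon_i,\varepsilon_j,\varepsilon_k):(i,j,k)\in\mathfrak{W}_m\}\subseteq(\mathbb{R}^m)^3$. For $r\geq2$: let $\mathrm{mod}'\,m$ denote reduction modulo $m$ with values in $[m]$ (outputting $m$ instead of $0$); for $i\in[r]$ define $\sigma_i:[rm]\to[m]$, $j\mapsto\lceil (j+i-1)/r\rceil\ \mathrm{mod}'\,m$, and for $i\in[r-1]$ define $\sigma_{r+i}:=\sigma_1\circ\tau_i$, where $\tau_i$ is the transposition of $r-i+1$ and $r+1$ in the symmetric group on $[rm]$. Write $\varepsilon_{\sigma(j)}:=(\varepsilon_{\sigma_1(j)},\dots,\varepsilon_{\sigma_{2r-1}(j)})\in(\mathbb{R}^m)^{2r-1}$, let $\mathfrak{J}_r:=\{(s,1,s),(s,s,1): s=2,\dots,r\}$, and $\Gamma_{m,6r-3}:=\{(\varepsilon_{\sigma(i)},\varepsilon_{\sigma(j)},\varepsilon_{\sigma(k)}):(i,j,k)\in\mathfrak{W}_{rm}\setminus\mathfrak{J}_r\}\subseteq(\mathbb{R}^m)^{6r-3}$. *)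

theory Defs
  imports
    "HOL-Analysis.Finite_Function_Topology"
    "HOL-Analysis.Derivative"
    "HOL-Analysis.L2_Norm"
    "HOL-Combinatorics.Transposition"
    "Jordan_Normal_Form.Gauss_Jordan_Elimination"
    "Jordan_Normal_Form.Schur_Decomposition"
begin

subsection \<open>The action of the special linear group on forms\<close>

text \<open>
  Polynomials are finitely supported maps from exponent vectors to coefficients; the product is
  the convolution product of \<^theory>\<open>HOL-Library.Poly_Mapping\<close>. Variables are numbered
  \<open>0, \<dots>, n - 1\<close> like the rows and columns of a matrix. The topology is the one of
  \<^theory>\<open>HOL-Analysis.Finite_Function_Topology\<close>, coming from the sum of the absolute values of the
  coefficients; on the finite-dimensional spaces of forms it is the Euclidean topology.
\<close>

type_synonym mpoly = "(nat \<Rightarrow>\<^sub>0 nat) \<Rightarrow>\<^sub>0 complex"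

definition forms :: "nat \<Rightarrow> nat \<Rightarrow> mpoly set" where
  "forms n d = {p. \<forall>a\<in>Poly_Mapping.keys p.
     Poly_Mapping.keys a \<subseteq> {..<n} \<and> (\<Sum>i<n. Poly_Mapping.lookup a i) = d}"

definition const_mpoly :: "complex \<Rightarrow> mpoly" where
  "const_mpoly c = Poly_Mapping.single 0 c"

definition var_mpoly :: "nat \<Rightarrow> mpoly" where
  "var_mpoly i = Poly_Mapping.single (Poly_Mapping.single i 1) 1"

definition subst_mpoly :: "(nat \<Rightarrow> mpoly) \<Rightarrow> mpoly \<Rightarrow> mpoly" where
  "subst_mpoly f p = (\<Sum>a\<in>Poly_Mapping.keys p.
     const_mpoly (Poly_Mapping.lookup p a) *
     (\<Prod>i\<in>Poly_Mapping.keys a. f i ^ Poly_Mapping.lookup a i))"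

definition SL :: "nat \<Rightarrow> complex mat set" where
  "SL n = {g \<in> carrier_mat n n. Determinant.det g = 1}"

definition SU :: "nat \<Rightarrow> complex mat set" where
  "SU n = {g \<in> SL n. g * mat_adjoint g = 1\<^sub>m n}"

text \<open>\<open>(g \<cdot> p)(x) = p(g\<^sup>-\<^sup>1 x)\<close>: the \<open>i\<close>-th variable is replaced by the
  \<open>i\<close>-th coordinate of \<open>g\<^sup>-\<^sup>1 x\<close>.\<close>

definition rep :: "complex mat \<Rightarrow> mpoly \<Rightarrow> mpoly" where
  "rep g = subst_mpoly (\<lambda>i. \<Sum>j<dim_row g. const_mpoly (the (mat_inverse g) $$ (i, j)) * var_mpoly j)"

definition mat_exp :: "complex mat \<Rightarrow> complex mat" where
  "mat_exp A = mat (dim_row A) (dim_row A) (\<lambda>(i, j). suminf (\<lambda>k. (A ^\<^sub>m k) $$ (i, j) / fact k))"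

definition lie_rep :: "complex mat \<Rightarrow> mpoly \<Rightarrow> mpoly" where
  "lie_rep A p = vector_derivative (\<lambda>t. rep (mat_exp (complex_of_real t \<cdot>\<^sub>m A)) p) (at 0)"


subsection \<open>Moment map and gap\<close>

text \<open>Inner products are antilinear in the first argument; only the values on
  \<^term>\<open>forms n d\<close> matter.\<close>

definition SU_invariant_inner :: "nat \<Rightarrow> nat \<Rightarrow> (mpoly \<Rightarrow> mpoly \<Rightarrow> complex) \<Rightarrow> bool" where
  "SU_invariant_inner n d ip \<longleftrightarrow>
     (\<forall>p\<in>forms n d. \<forall>q\<in>forms n d. ip q p = cnj (ip p q)) \<and>
     (\<forall>p\<in>forms n d. \<forall>q\<in>forms n d. \<forall>r\<in>forms n d. ip p (q + r) = ip p q + ip p r) \<and>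
     (\<forall>p\<in>forms n d. \<forall>q\<in>forms n d. \<forall>c. ip p (const_mpoly c * q) = c * ip p q) \<and>
     (\<forall>p\<in>forms n d. p \<noteq> 0 \<longrightarrow> Re (ip p p) > 0) \<and>
     (\<forall>g\<in>SU n. \<forall>p\<in>forms n d. \<forall>q\<in>forms n d. ip (rep g p) (rep g q) = ip p q)"

definition mat_trace :: "complex mat \<Rightarrow> complex" where
  "mat_trace A = (\<Sum>i<dim_row A. A $$ (i, i))"

definition frobenius_norm :: "complex mat \<Rightarrow> real" where
  "frobenius_norm A = sqrt (\<Sum>i<dim_row A. \<Sum>j<dim_col A. (cmod (A $$ (i, j)))\<^sup>2)"

definition traceless_hermitian :: "nat \<Rightarrow> complex mat set" where
  "traceless_hermitian n = {A \<in> carrier_mat n n. mat_adjoint A = A \<and> mat_trace A = 0}"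

definition moment_map :: "nat \<Rightarrow> (mpoly \<Rightarrow> mpoly \<Rightarrow> complex) \<Rightarrow> mpoly \<Rightarrow> complex mat" where
  "moment_map n ip v = (THE H. H \<in> traceless_hermitian n \<and>
     (\<forall>A\<in>traceless_hermitian n. mat_trace (H * A) = ip v (lie_rep A v) / ip v v))"

definition unstable :: "nat \<Rightarrow> mpoly \<Rightarrow> bool" where
  "unstable n v \<longleftrightarrow> 0 \<in> closure ((\<lambda>g. rep g v) ` SL n)"

text \<open>The infimum is attained, because the unstable vectors form a closed cone and the moment map
  is continuous and invariant under scaling; so this is the minimum.\<close>

definition gap :: "nat \<Rightarrow> nat \<Rightarrow> (mpoly \<Rightarrow> mpoly \<Rightarrow> complex) \<Rightarrow> real" where
  "gap n d ip = Inf {frobenius_norm (moment_map n ip v) | v. v \<in> forms n d \<and> v \<noteq> 0 \<and> unstable n v}"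


subsection \<open>The weight sets\<close>

text \<open>
  An element of \<open>(\<real>\<^sup>m)\<^sup>d\<close> is a finitely supported map whose argument \<open>(b, k)\<close>, with \<open>b < d\<close> and
  \<open>k \<in> {1..m}\<close>, stands for the \<open>k\<close>-th coordinate in the block number \<open>b\<close>. The library norm on this
  type is the sum of the absolute values, hence the Euclidean distance is spelled out below.
\<close>

type_synonym blockvec = "(nat \<times> nat) \<Rightarrow>\<^sub>0 real"

definition eps :: "nat \<Rightarrow> nat \<Rightarrow> nat \<Rightarrow> blockvec" where
  "eps m b i = Poly_Mapping.single (b, i) 1 - (\<Sum>k=1..m. Poly_Mapping.single (b, k) (1 / real m))"

definition eps_tuple :: "nat \<Rightarrow> nat list \<Rightarrow> blockvec" where
  "eps_tuple m is = (\<Sum>b<length is. eps m b (is ! b))"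

definition euclid_dist_0 :: "blockvec set \<Rightarrow> real" where
  "euclid_dist_0 S = (INF x\<in>S. L2_set (Poly_Mapping.lookup x) (Poly_Mapping.keys x))"

definition W_set :: "nat \<Rightarrow> (nat \<times> nat \<times> nat) set" where
  "W_set N = (\<Union>s\<in>{2..N}. {(s, 1, s), (s, s, 1), (s - 1, s, s)})"

definition J_set :: "nat \<Rightarrow> (nat \<times> nat \<times> nat) set" where
  "J_set r = (\<Union>s\<in>{2..r}. {(s, 1, s), (s, s, 1)})"

definition mod' :: "nat \<Rightarrow> nat \<Rightarrow> nat" where
  "mod' x m = (if x mod m = 0 then m else x mod m)"

definition sigma_low :: "nat \<Rightarrow> nat \<Rightarrow> nat \<Rightarrow> nat \<Rightarrow> nat" where
  "sigma_low r m i j = mod' (nat \<lceil>(real j + real i - 1) / real r\<rceil>) m"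

text \<open>For \<open>l = r + i\<close> with \<open>1 \<le> i \<le> r - 1\<close> the transposition swaps \<open>r - i + 1\<close> and \<open>r + 1\<close>.\<close>

definition sigma :: "nat \<Rightarrow> nat \<Rightarrow> nat \<Rightarrow> nat \<Rightarrow> nat" where
  "sigma r m l = (if l \<le> r then sigma_low r m l
     else sigma_low r m 1 \<circ> Transposition.transpose (r - (l - r) + 1) (r + 1))"

definition sigma_list :: "nat \<Rightarrow> nat \<Rightarrow> nat \<Rightarrow> nat list" where
  "sigma_list r m j = map (\<lambda>l. sigma r m l j) [1..<2 * r]"

definition Gamma3 :: "nat \<Rightarrow> blockvec set" where
  "Gamma3 m = {eps_tuple m [i, j, k] | i j k. (i, j, k) \<in> W_set m}"

definition Gamma_odd :: "nat \<Rightarrow> nat \<Rightarrow> blockvec set" where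
  "Gamma_odd m r = {eps_tuple m (sigma_list r m i @ sigma_list r m j @ sigma_list r m k) | i j k.
     (i, j, k) \<in> W_set (r * m) - J_set r}"

end

theory Submission
  imports Defs
begin

text \<open>
  A form supported on a free set of monomials (no two exponents differ by a root \<open>e\<^sub>i - e\<^sub>j\<close>) has a
  diagonal moment map: torus invariance makes distinct monomials orthogonal, so only the diagonal of
  the Lie algebra contributes. The diagonal is minus the convex combination of the weights with
  coefficients \<open>|c\<^sub>a|\<^sup>2 \<parallel>x\<^sup>a\<parallel>\<^sup>2\<close>, and every convex combination arises. If moreover some traceless
  diagonal matrix pairs to \<open>1\<close> with all the weights, its one-parameter group scales the form to \<open>0\<close>,
  so the form is unstable and the gap is bounded by the distance of \<open>0\<close> to the convex hull.

  For \<open>x\<^sub>b\<^sub>,\<^sub>k\<close> with \<open>b < d\<close> and \<open>1 \<le> k \<le> m\<close> the weight of a multilinear monomial is the tuple of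
  \<open>\<epsilon>\<close>'s of its indices, and a set of tuples is free as soon as any two differ in two blocks.
  On \<open>\<W>\<^sub>N\<close> with \<open>N = r m\<close> (minus \<open>\<J>\<^sub>r\<close>) geometrically growing weights give almost uniform
  marginals, with an error proportional to \<open>2\<^sup>r\<^sup>-\<^sup>N\<close>. The maps \<open>\<sigma>\<^sub>l\<close> have fibres of size \<open>r\<close>, so
  they preserve uniformity, and their fibre indicators span all functions on \<open>[N]\<close>, which pulls the
  separating functional for \<open>\<W>\<^sub>N\<close> back to the blocks. Repeating a block reaches the other degrees.
\<close>

subsection \<open>Matrix exponential\<close>

text \<open>Instability wants the weights on an affine hyperplane that misses \<open>0\<close>; a
  small moment map wants their hull to come close to \<open>0\<close>. A functional with value
  \<open>1\<close> on the hull has norm at least the inverse of the distance, so exponentially large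
  values are unavoidable. In \<open>W_set N\<close> one and the same doubling along \<open>s\<close>
  makes the functional large and the defect of the marginals small. The chain of doublings has
  length about \<open>N = r * m\<close>, although each block offers only \<open>m\<close> values;
  this is why functions on \<open>[N]\<close> must be written as sums of functions of the single
  entries \<open>sigma r m l j\<close>. The distance is an infimum, and no minimiser enters: every
  point of the hull is realised by its own unstable form, whose moment map has the norm of that
  point. The inner product is known only through its invariance; the unknown norms of the monomials
  are absorbed into the coefficients of the form.\<close>

lemma mat_inverse_eqI:
  fixes A B :: "'a::field mat"
  assumes A: "A \<in> carrier_mat n n" and B: "B \<in> carrier_mat n n"
    and AB: "A * B = 1\<^sub>m n" and BA: "B * A = 1\<^sub>m n"
  shows "mat_inverse A = Some B"
proof (cases "mat_inverse A")
  case None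
  have "A \<in> Units (ring_mat TYPE('a) n ())"
    using A B AB BA by (auto simp: Units_def ring_mat_def)
  with mat_inverse(1)[OF A None, where b = "()"] show ?thesis by blast
next
  case (Some C)
  from mat_inverse(2)[OF A Some] have C: "C * A = 1\<^sub>m n" "C \<in> carrier_mat n n" by auto
  have "C = C * (A * B)" using AB C(2) by simp
  also have "\<dots> = (C * A) * B" using A B C(2) by simp
  also have "\<dots> = B" using C B by simp
  finally show ?thesis using Some by simp
qed

lemma pow_mat_add:
  assumes A: "A \<in> carrier_mat n n"
  shows "A ^\<^sub>m (p + q) = A ^\<^sub>m p * A ^\<^sub>m q"
proof (induction q)
  case 0
  then show ?case using A pow_carrier_mat[OF A, of p] by simp
next
  case (Suc q)
  then show ?case
    using A pow_carrier_mat[OF A] by (simp add: assoc_mult_mat[of _ n n _ n _ n])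
qed

lemma pow_smult_mat:
  assumes A: "A \<in> carrier_mat n n"
  shows "(c \<cdot>\<^sub>m A) ^\<^sub>m k = (c ^ k :: 'a::comm_ring_1) \<cdot>\<^sub>m (A ^\<^sub>m k)"
proof (induction k)
  case 0
  then show ?case by (intro eq_matI) auto
next
  case (Suc k)
  have P: "A ^\<^sub>m k \<in> carrier_mat n n" by (rule pow_carrier_mat[OF A])
  have "(c \<cdot>\<^sub>m A) ^\<^sub>m Suc k = (c ^ k \<cdot>\<^sub>m A ^\<^sub>m k) * (c \<cdot>\<^sub>m A)"
    using Suc by simp
  also have "\<dots> = c ^ k \<cdot>\<^sub>m (A ^\<^sub>m k * (c \<cdot>\<^sub>m A))"
    using P A by (intro mult_smult_assoc_mat) auto
  also have "A ^\<^sub>m k * (c \<cdot>\<^sub>m A) = c \<cdot>\<^sub>m (A ^\<^sub>m k * A)"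
    using P A by (intro mult_smult_distrib) auto
  finally show ?case by (intro eq_matI) (auto simp: mult_ac)
qed

lemma norm_pow_mat_le:
  fixes A :: "complex mat"
  assumes A: "A \<in> carrier_mat n n"
    and M: "\<And>i j. i < n \<Longrightarrow> j < n \<Longrightarrow> cmod (A $$ (i, j)) \<le> M"
    and ij: "i < n" "j < n"
  shows "cmod ((A ^\<^sub>m k) $$ (i, j)) \<le> (real n * M) ^ k"
  using ij
proof (induction k arbitrary: i j)
  case 0
  then show ?case using A by auto
next
  case (Suc k)
  have M0: "M \<ge> 0" using M[OF Suc.prems] norm_ge_zero order_trans by blast
  have P: "A ^\<^sub>m k \<in> carrier_mat n n" by (rule pow_carrier_mat[OF A])
  have "(A ^\<^sub>m Suc k) $$ (i, j) = (\<Sum>l<n. (A ^\<^sub>m k) $$ (i, l) * A $$ (l, j))"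
    using A P Suc.prems by (simp add: scalar_prod_def atLeast0LessThan)
  also have "cmod \<dots> \<le> (\<Sum>l<n. (real n * M) ^ k * M)"
    using Suc M M0 by (intro sum_norm_le) (auto simp: norm_mult intro!: mult_mono)
  also have "\<dots> = (real n * M) ^ Suc k" by simp
  finally show ?case .
qed

text \<open>Comparison with the exponential series of \<open>n * M\<close>, where \<open>M\<close>
  bounds all entries. The sum of all moduli serves as \<open>M\<close>, which also makes sense for
  the empty matrix.\<close>

lemma summable_norm_mat_exp:
  fixes A :: "complex mat"
  assumes A: "A \<in> carrier_mat n n" and ij: "i < n" "j < n"
  shows "summable (\<lambda>k. norm ((A ^\<^sub>m k) $$ (i, j) / fact k))"
proof -
  define M where "M = (\<Sum>i<n. \<Sum>j<n. cmod (A $$ (i, j)))"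
  have M: "cmod (A $$ (i, j)) \<le> M" if "i < n" "j < n" for i j
  proof -
    have "cmod (A $$ (i, j)) \<le> (\<Sum>j<n. cmod (A $$ (i, j)))"
      using that by (intro member_le_sum) auto
    also have "\<dots> \<le> M" unfolding M_def
      using that by (intro member_le_sum[where f = "\<lambda>i. \<Sum>j<n. cmod (A $$ (i, j))"]) (auto intro: sum_nonneg)
    finally show ?thesis .
  qed
  have "summable (\<lambda>k. (real n * M) ^ k / fact k)"
    using summable_exp[of "real n * M"] by (simp add: field_simps)
  then show ?thesis
    by (rule summable_comparison_test')
       (use norm_pow_mat_le[OF A M ij] in \<open>auto simp: norm_divide intro!: divide_right_mono\<close>)
qed

lemma mat_exp_carrier: "A \<in> carrier_mat n n \<Longrightarrow> mat_exp A \<in> carrier_mat n n"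
  by (auto simp: mat_exp_def)

lemma mat_exp_smult_index:
  fixes A :: "complex mat"
  assumes A: "A \<in> carrier_mat n n" and ij: "i < n" "j < n"
  shows "mat_exp (c \<cdot>\<^sub>m A) $$ (i, j) = suminf (\<lambda>k. ((A ^\<^sub>m k) $$ (i, j) / fact k) * c ^ k)"
  using A ij by (simp add: mat_exp_def pow_smult_mat[OF A] mult_ac)

text \<open>This is \<open>(1 - 1) ^ k / fact k\<close> by the binomial theorem; it is the
  coefficient of \<open>A ^\<^sub>m k\<close> in the product of the exponentials of \<open>A\<close>
  and \<open>-A\<close>.\<close>

lemma alternating_fact_sum:
  "(\<Sum>p\<le>k. (-1) ^ (k - p) / (fact p * fact (k - p))) = (if k = 0 then 1 else 0 :: complex)"
proof -
  have "(\<Sum>p\<le>k. (-1) ^ (k - p) / (fact p * fact (k - p)))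
      = (\<Sum>p\<le>k. of_nat (k choose p) * 1 ^ p * (-1) ^ (k - p)) / (fact k :: complex)"
    unfolding sum_divide_distrib
    by (intro sum.cong) (auto simp: binomial_fact field_simps)
  also have "\<dots> = (1 + (-1)) ^ k / fact k"
    by (subst binomial_ring) simp
  finally show ?thesis by auto
qed

text \<open>Each entry is a finite sum of Cauchy products of absolutely convergent series. Swapping
  the sum over the middle index with the convolution sum collects the coefficient of
  \<open>A ^\<^sub>m k\<close>, which vanishes for positive \<open>k\<close>.\<close>

lemma mat_exp_mult_uminus:
  fixes A :: "complex mat"
  assumes A: "A \<in> carrier_mat n n"
  shows "mat_exp A * mat_exp ((-1) \<cdot>\<^sub>m A) = 1\<^sub>m n"
proof (rule eq_matI)
  fix i j assume ij: "i < dim_row (1\<^sub>m n :: complex mat)" "j < dim_col (1\<^sub>m n :: complex mat)"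
  hence ij: "i < n" "j < n" by auto
  have A': "(-1) \<cdot>\<^sub>m A \<in> carrier_mat n n" using A by simp
  have "(mat_exp A * mat_exp ((-1) \<cdot>\<^sub>m A)) $$ (i, j)
     = (\<Sum>l<n. mat_exp A $$ (i, l) * mat_exp ((-1) \<cdot>\<^sub>m A) $$ (l, j))"
    using ij A mat_exp_carrier[OF A] mat_exp_carrier[OF A']
    by (simp add: scalar_prod_def atLeast0LessThan)
  moreover have "(\<lambda>k. \<Sum>l<n. \<Sum>p\<le>k. ((A ^\<^sub>m p) $$ (i, l) / fact p) *
        ((((-1) \<cdot>\<^sub>m A) ^\<^sub>m (k - p)) $$ (l, j) / fact (k - p)))
     sums (\<Sum>l<n. mat_exp A $$ (i, l) * mat_exp ((-1) \<cdot>\<^sub>m A) $$ (l, j))"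
  proof (intro sums_sum)
    fix l assume "l \<in> {..<n}"
    then have l: "l < n" by simp
    show "(\<lambda>k. \<Sum>p\<le>k. ((A ^\<^sub>m p) $$ (i, l) / fact p) *
        ((((-1) \<cdot>\<^sub>m A) ^\<^sub>m (k - p)) $$ (l, j) / fact (k - p)))
      sums (mat_exp A $$ (i, l) * mat_exp ((-1) \<cdot>\<^sub>m A) $$ (l, j))"
      using Cauchy_product_sums[OF summable_norm_mat_exp[OF A ij(1) l]
          summable_norm_mat_exp[OF A' l ij(2)]] A A' ij l
      by (simp add: mat_exp_def)
  qed
  moreover have "(\<Sum>l<n. \<Sum>p\<le>k. ((A ^\<^sub>m p) $$ (i, l) / fact p) *
        ((((-1) \<cdot>\<^sub>m A) ^\<^sub>m (k - p)) $$ (l, j) / fact (k - p)))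
      = (if k = 0 then 1\<^sub>m n $$ (i, j) else 0)" (is "?L = _") for k
  proof -
    have "?L = (\<Sum>p\<le>k. \<Sum>l<n. ((A ^\<^sub>m p) $$ (i, l) / fact p) *
        ((((-1) \<cdot>\<^sub>m A) ^\<^sub>m (k - p)) $$ (l, j) / fact (k - p)))"
      by (rule sum.swap)
    also have "\<dots> = (\<Sum>p\<le>k. (-1) ^ (k - p) / (fact p * fact (k - p)) * (A ^\<^sub>m k) $$ (i, j))"
    proof (rule sum.cong[OF refl])
      fix p assume "p \<in> {..k}"
      then have k: "k = p + (k - p)" by simp
      have "(A ^\<^sub>m p * A ^\<^sub>m (k - p)) $$ (i, j)
          = (\<Sum>l<n. (A ^\<^sub>m p) $$ (i, l) * (A ^\<^sub>m (k - p)) $$ (l, j))"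
        using ij A pow_carrier_mat[OF A, of p] pow_carrier_mat[OF A, of "k - p"]
        by (auto simp: scalar_prod_def atLeast0LessThan)
      with pow_mat_add[OF A, of p "k - p"] k
      have "(A ^\<^sub>m k) $$ (i, j) = (\<Sum>l<n. (A ^\<^sub>m p) $$ (i, l) * (A ^\<^sub>m (k - p)) $$ (l, j))"
        by simp
      then show "(\<Sum>l<n. ((A ^\<^sub>m p) $$ (i, l) / fact p) *
        ((((-1) \<cdot>\<^sub>m A) ^\<^sub>m (k - p)) $$ (l, j) / fact (k - p)))
        = (-1) ^ (k - p) / (fact p * fact (k - p)) * (A ^\<^sub>m k) $$ (i, j)"
        using A ij pow_carrier_mat[OF A, of "k - p"]
        by (simp add: pow_smult_mat[OF A] sum_distrib_left mult_ac)
    qed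
    also have "\<dots> = (if k = 0 then 1\<^sub>m n $$ (i, j) else 0)"
      by (simp only: sum_distrib_right[symmetric] alternating_fact_sum) (use A in simp)
    finally show ?thesis .
  qed
  ultimately have "(\<lambda>k. if k = 0 then 1\<^sub>m n $$ (i, j) else 0)
      sums ((mat_exp A * mat_exp ((-1) \<cdot>\<^sub>m A)) $$ (i, j))"
    by simp
  moreover have "(\<lambda>k. if k = 0 then 1\<^sub>m n $$ (i, j) else 0 :: complex) sums (1\<^sub>m n $$ (i, j))"
    using sums_single[of 0 "\<lambda>_. 1\<^sub>m n $$ (i, j) :: complex"] by simp
  ultimately show "(mat_exp A * mat_exp ((-1) \<cdot>\<^sub>m A)) $$ (i, j) = 1\<^sub>m n $$ (i, j)"
    using sums_unique2 by blast
qed (use assms in \<open>auto simp: mat_exp_def\<close>)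

text \<open>The action substitutes the inverse matrix, so along the curve
  \<open>mat_exp (t A)\<close> the coefficients that get substituted are the entries of
  \<open>mat_exp (- t A)\<close>.\<close>

lemma mat_inverse_mat_exp:
  fixes A :: "complex mat"
  assumes A: "A \<in> carrier_mat n n"
  shows "mat_inverse (mat_exp (c \<cdot>\<^sub>m A)) = Some (mat_exp ((- c) \<cdot>\<^sub>m A))"
proof -
  have *: "(-1) \<cdot>\<^sub>m (e \<cdot>\<^sub>m A) = (- e) \<cdot>\<^sub>m A" for e :: complex
    by (intro eq_matI) auto
  show ?thesis
    using A mat_exp_mult_uminus[of "c \<cdot>\<^sub>m A" n] mat_exp_mult_uminus[of "(-c) \<cdot>\<^sub>m A" n]
    by (intro mat_inverse_eqI[where n = n] mat_exp_carrier) (auto simp: *)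
qed

lemma mat_exp_zero:
  fixes A :: "complex mat"
  assumes A: "A \<in> carrier_mat n n"
  shows "mat_exp (0 \<cdot>\<^sub>m A) = 1\<^sub>m n"
proof (rule eq_matI)
  fix i j assume "i < dim_row (1\<^sub>m n :: complex mat)" "j < dim_col (1\<^sub>m n :: complex mat)"
  then show "mat_exp (0 \<cdot>\<^sub>m A) $$ (i, j) = 1\<^sub>m n $$ (i, j)"
    using A powser_zero[of "\<lambda>k. (A ^\<^sub>m k) $$ (i, j) / fact k"]
    by (subst mat_exp_smult_index[OF A]) auto
qed (use assms in \<open>auto simp: mat_exp_def\<close>)

text \<open>Every entry is an everywhere convergent power series in a complex variable; it is
  differentiated termwise and then restricted to the real axis. The sign in \<open>c\<close> comes
  from the inverse in the action.\<close>

lemma mat_exp_has_vector_derivative: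
  fixes A :: "complex mat"
  assumes A: "A \<in> carrier_mat n n" and ij: "i < n" "j < n"
  shows "((\<lambda>t. mat_exp ((- complex_of_real t) \<cdot>\<^sub>m A) $$ (i, j)) has_vector_derivative - A $$ (i, j)) (at 0)"
proof -
  define c where "c = (\<lambda>k. (-1) ^ k * ((A ^\<^sub>m k) $$ (i, j) / fact k))"
  have eq: "mat_exp ((- z) \<cdot>\<^sub>m A) $$ (i, j) = suminf (\<lambda>k. c k * z ^ k)" for z
    using mat_exp_smult_index[OF A ij, of "- z"] by (simp add: c_def power_minus[of z] mult_ac)
  have "summable (\<lambda>k. c k * z ^ k)" for z
  proof -
    have "(\<lambda>k. c k * z ^ k) = (\<lambda>k. (((- z) \<cdot>\<^sub>m A) ^\<^sub>m k) $$ (i, j) / fact k)"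
      using A ij by (auto simp: c_def pow_smult_mat[OF A] power_minus[of z] mult_ac)
    then show ?thesis
      using summable_norm_cancel[OF summable_norm_mat_exp[of "(- z) \<cdot>\<^sub>m A" n i j]] A ij by simp
  qed
  then have "((\<lambda>z. suminf (\<lambda>k. c k * z ^ k)) has_field_derivative suminf (\<lambda>k. diffs c k * 0 ^ k)) (at 0)"
    by (rule termdiffs_strong_converges_everywhere)
  also have "suminf (\<lambda>k. diffs c k * 0 ^ k) = - A $$ (i, j)"
    using A ij powser_zero[of "diffs c"] by (simp add: diffs_def c_def)
  finally have "((\<lambda>z. suminf (\<lambda>k. c k * z ^ k)) has_field_derivative - A $$ (i, j)) (at (complex_of_real 0))"
    by simp
  from has_vector_derivative_real_field[OF this] show ?thesis by (simp add: eq)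
qed

subsection \<open>Substitution into monomials\<close>

abbreviation xpow :: "(nat \<Rightarrow>\<^sub>0 nat) \<Rightarrow> mpoly" where
  "xpow a \<equiv> Poly_Mapping.single a 1"

lemma poly_mapping_sum_single:
  fixes p :: "'a \<Rightarrow>\<^sub>0 'b::comm_monoid_add"
  assumes "finite S" "Poly_Mapping.keys p \<subseteq> S"
  shows "p = (\<Sum>a\<in>S. Poly_Mapping.single a (Poly_Mapping.lookup p a))"
proof (rule poly_mapping_eqI)
  fix b
  show "Poly_Mapping.lookup p b = Poly_Mapping.lookup (\<Sum>a\<in>S. Poly_Mapping.single a (Poly_Mapping.lookup p a)) b"
    using assms
    by (auto simp: lookup_sum lookup_single when_def in_keys_iff subset_iff)
qed

lemma norm_single_poly_mapping:
  fixes c :: "'b::real_normed_vector"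
  shows "norm (Poly_Mapping.single a c) = norm c"
  by (simp add: norm_poly_mapping_def dist_poly_mapping_def)

lemma norm_poly_mapping_sum:
  fixes p :: "'a \<Rightarrow>\<^sub>0 'b::real_normed_vector"
  shows "norm p = (\<Sum>a\<in>Poly_Mapping.keys p. norm (Poly_Mapping.lookup p a))"
  by (simp add: norm_poly_mapping_def dist_poly_mapping_def)

text \<open>The norm is the sum of the absolute values of the coefficients, hence submultiplicative
  under convolution. This makes multiplication bounded bilinear, from which the product rule for
  curves of polynomials follows.\<close>

lemma norm_mult_mpoly_le: "norm (p * q) \<le> norm p * norm (q :: mpoly)"
proof -
  let ?P = "Poly_Mapping.keys p" and ?Q = "Poly_Mapping.keys q"
  have "p * q = (\<Sum>a\<in>?P. Poly_Mapping.single a (Poly_Mapping.lookup p a)) *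
      (\<Sum>b\<in>?Q. Poly_Mapping.single b (Poly_Mapping.lookup q b))"
    using poly_mapping_sum_single[of ?P p] poly_mapping_sum_single[of ?Q q] by simp
  also have "\<dots> = (\<Sum>a\<in>?P. \<Sum>b\<in>?Q.
      Poly_Mapping.single (a + b) (Poly_Mapping.lookup p a * Poly_Mapping.lookup q b))"
    by (simp add: sum_product mult_single)
  also have "norm \<dots> \<le> (\<Sum>a\<in>?P. \<Sum>b\<in>?Q. norm (Poly_Mapping.lookup p a) * norm (Poly_Mapping.lookup q b))"
    by (intro sum_norm_le) (simp add: norm_single_poly_mapping norm_mult)
  also have "\<dots> = norm p * norm q"
    by (simp add: norm_poly_mapping_sum sum_product)
  finally show ?thesis .
qed

lemma scaleR_mpoly: "r *\<^sub>R (p :: mpoly) = const_mpoly (complex_of_real r) * p"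
proof (rule poly_mapping_eqI)
  fix k
  have "Poly_Mapping.lookup (const_mpoly (complex_of_real r) * p) k
      = Poly_Mapping.lookup (Poly_Mapping.map ((*) (complex_of_real r)) p) k"
    by (simp add: const_mpoly_def mult_map_scale_conv_mult)
  also have "\<dots> = complex_of_real r * Poly_Mapping.lookup p k"
    by (simp add: Poly_Mapping.map.rep_eq when_def)
  finally show "Poly_Mapping.lookup (r *\<^sub>R p) k = Poly_Mapping.lookup (const_mpoly (complex_of_real r) * p) k"
    by (simp add: scaleR_poly_mapping_def Poly_Mapping.map.rep_eq when_def scaleR_conv_of_real)
qed

lemma bounded_bilinear_mult_mpoly: "bounded_bilinear ((*) :: mpoly \<Rightarrow> mpoly \<Rightarrow> mpoly)"
proof
  show "\<exists>K. \<forall>a b :: mpoly. norm (a * b) \<le> norm a * norm b * K"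
    using norm_mult_mpoly_le by (intro exI[of _ 1]) simp
qed (auto simp: algebra_simps scaleR_mpoly)

lemma const_mpoly_add: "const_mpoly (a + b) = const_mpoly a + const_mpoly b"
  by (simp add: const_mpoly_def single_add)

lemma const_mpoly_mult: "const_mpoly (a * b) = const_mpoly a * const_mpoly b"
  by (simp add: const_mpoly_def mult_single)

lemma const_mpoly_0 [simp]: "const_mpoly 0 = 0"
  by (simp add: const_mpoly_def)

lemma const_mpoly_1 [simp]: "const_mpoly 1 = 1"
  by (simp add: const_mpoly_def)

lemma const_mpoly_power: "const_mpoly (a ^ k) = const_mpoly a ^ k"
  by (induction k) (auto simp: const_mpoly_mult)

lemma const_mpoly_prod: "const_mpoly (prod f S) = (\<Prod>x\<in>S. const_mpoly (f x))"
  by (induction S rule: infinite_finite_induct) (auto simp: const_mpoly_mult)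

lemma const_mpoly_mult_single: "const_mpoly c * Poly_Mapping.single a b = Poly_Mapping.single a (c * b)"
  by (simp add: const_mpoly_def mult_single)

lemma bounded_linear_const_mpoly: "bounded_linear const_mpoly"
proof
  show "const_mpoly (r *\<^sub>R x) = r *\<^sub>R const_mpoly x" for r x
    by (simp add: scaleR_mpoly const_mpoly_mult scaleR_conv_of_real)
  show "\<exists>K. \<forall>x. norm (const_mpoly x) \<le> norm x * K"
    by (intro exI[of _ 1]) (simp add: const_mpoly_def norm_single_poly_mapping)
qed (simp add: const_mpoly_add)

lemma prod_var_mpoly_power:
  assumes "finite K"
  shows "(\<Prod>i\<in>K. var_mpoly i ^ e i) = xpow (\<Sum>i\<in>K. Poly_Mapping.single i (e i))"
proof -
  have "var_mpoly i ^ k = xpow (Poly_Mapping.single i k)" for i k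
    by (induction k) (auto simp: var_mpoly_def mult_single single_add[symmetric])
  note power = this
  show ?thesis
    using assms by (induction K rule: finite_induct) (auto simp: power mult_single)
qed

text \<open>The forms below are written over a fixed set \<open>S\<close> of exponents, but some
  coefficients may be zero, so the support can be smaller than \<open>S\<close>.\<close>

lemma subst_mpoly_supset:
  assumes "finite S" "Poly_Mapping.keys p \<subseteq> S"
  shows "subst_mpoly f p = (\<Sum>a\<in>S. const_mpoly (Poly_Mapping.lookup p a) *
     (\<Prod>i\<in>Poly_Mapping.keys a. f i ^ Poly_Mapping.lookup a i))"
  unfolding subst_mpoly_def
  using assms by (intro sum.mono_neutral_left) (auto simp: in_keys_iff)

lemma has_vector_derivative_mpoly_power:
  fixes f :: "real \<Rightarrow> mpoly"
  assumes "(f has_vector_derivative f') (at x)"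
  shows "((\<lambda>t. f t ^ k) has_vector_derivative of_nat k * f' * f x ^ (k - 1)) (at x)"
proof (induction k)
  case 0
  then show ?case by simp
next
  case (Suc k)
  have "((\<lambda>t. f t * f t ^ k) has_vector_derivative
      f x * (of_nat k * f' * f x ^ (k - 1)) + f' * f x ^ k) (at x)"
    by (rule bounded_bilinear.has_vector_derivative[OF bounded_bilinear_mult_mpoly assms Suc])
  moreover have "f x * (of_nat k * f' * f x ^ (k - 1)) + f' * f x ^ k
      = of_nat (Suc k) * f' * f x ^ (Suc k - 1)"
    by (cases k) (auto simp: algebra_simps)
  ultimately show ?case by simp
qed

lemma has_vector_derivative_mpoly_prod:
  fixes f :: "'a \<Rightarrow> real \<Rightarrow> mpoly"
  assumes "finite K" and "\<And>i. i \<in> K \<Longrightarrow> (f i has_vector_derivative f' i) (at x)"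
  shows "((\<lambda>t. \<Prod>i\<in>K. f i t) has_vector_derivative (\<Sum>i\<in>K. f' i * (\<Prod>j\<in>K-{i}. f j x))) (at x)"
  using assms
proof (induction K rule: finite_induct)
  case (insert k K)
  have "((\<lambda>t. f k t * (\<Prod>i\<in>K. f i t)) has_vector_derivative
      f k x * (\<Sum>i\<in>K. f' i * (\<Prod>j\<in>K-{i}. f j x)) + f' k * (\<Prod>i\<in>K. f i x)) (at x)"
    by (rule bounded_bilinear.has_vector_derivative[OF bounded_bilinear_mult_mpoly])
       (use insert in auto)
  moreover have "(\<Sum>i\<in>insert k K. f' i * (\<Prod>j\<in>insert k K - {i}. f j x))
      = f k x * (\<Sum>i\<in>K. f' i * (\<Prod>j\<in>K-{i}. f j x)) + f' k * (\<Prod>i\<in>K. f i x)"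
  proof -
    have "f' i * (\<Prod>j\<in>insert k K - {i}. f j x) = f k x * (f' i * (\<Prod>j\<in>K-{i}. f j x))"
      if "i \<in> K" for i
    proof -
      have "insert k K - {i} = insert k (K - {i})" using that insert by auto
      then show ?thesis using insert by (simp add: mult_ac)
    qed
    then have "(\<Sum>i\<in>K. f' i * (\<Prod>j\<in>insert k K - {i}. f j x))
        = (\<Sum>i\<in>K. f k x * (f' i * (\<Prod>j\<in>K-{i}. f j x)))"
      by (rule sum.cong[OF refl])
    moreover have "insert k K - {k} = K" using insert by auto
    ultimately show ?thesis
      by (simp only: sum.insert[OF insert.hyps] sum_distrib_left add.commute)
  qed
  ultimately show ?case using insert.hyps by (simp add: add.commute)
qed simp

text \<open>Leibniz rule at a point where the substitution is the identity: each factor in turn is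
  differentiated and the others stay variables. The subtraction in the exponent is exact, since
  \<open>i\<close> ranges over the support of \<open>a\<close>.\<close>

lemma subst_monomial_derivative:
  fixes f :: "nat \<Rightarrow> real \<Rightarrow> mpoly"
  assumes "\<And>i. i \<in> Poly_Mapping.keys a \<Longrightarrow> (f i has_vector_derivative f' i) (at x)"
    and "\<And>i. i \<in> Poly_Mapping.keys a \<Longrightarrow> f i x = var_mpoly i"
  shows "((\<lambda>t. \<Prod>i\<in>Poly_Mapping.keys a. f i t ^ Poly_Mapping.lookup a i) has_vector_derivative
    (\<Sum>i\<in>Poly_Mapping.keys a. of_nat (Poly_Mapping.lookup a i) * f' i * xpow (a - Poly_Mapping.single i 1))) (at x)"
proof -
  let ?K = "Poly_Mapping.keys a" and ?e = "Poly_Mapping.lookup a"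
  have "((\<lambda>t. \<Prod>i\<in>?K. f i t ^ ?e i) has_vector_derivative
     (\<Sum>i\<in>?K. (of_nat (?e i) * f' i * f i x ^ (?e i - 1)) * (\<Prod>j\<in>?K-{i}. f j x ^ ?e j))) (at x)"
    using assms(1) by (intro has_vector_derivative_mpoly_prod has_vector_derivative_mpoly_power) auto
  moreover have "f i x ^ (?e i - 1) * (\<Prod>j\<in>?K-{i}. f j x ^ ?e j) = xpow (a - Poly_Mapping.single i 1)"
    if i: "i \<in> ?K" for i
  proof -
    \<comment> \<open>The exponents that remain after one factor \<open>var_mpoly i\<close> has been
      replaced by its derivative.\<close>
    let ?g = "\<lambda>j. if j = i then ?e i - 1 else ?e j"
    have "f i x ^ (?e i - 1) * (\<Prod>j\<in>?K-{i}. f j x ^ ?e j) = (\<Prod>j\<in>?K. var_mpoly j ^ ?g j)"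
      using i assms(2) by (subst prod.remove[of ?K i]) (auto intro!: arg_cong2[where f = "(*)"] prod.cong)
    also have "\<dots> = xpow (\<Sum>j\<in>?K. Poly_Mapping.single j (?g j))"
      by (rule prod_var_mpoly_power) simp
    also have "(\<Sum>j\<in>?K. Poly_Mapping.single j (?g j)) = a - Poly_Mapping.single i 1"
      by (rule poly_mapping_eqI)
         (auto simp: lookup_sum lookup_single when_def lookup_minus in_keys_iff)
    finally show ?thesis .
  qed
  ultimately show ?thesis by (simp add: mult.assoc)
qed

lemma subst_var_mpoly_one: 
  assumes "i < n" shows "(\<Sum>j<n. const_mpoly (1\<^sub>m n $$ (i, j)) * var_mpoly j) = var_mpoly i"
proof -
  have "(\<Sum>j<n. const_mpoly (1\<^sub>m n $$ (i, j)) * var_mpoly j) = (\<Sum>j<n. if i = j then var_mpoly j else 0)"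
    using assms by (intro sum.cong) auto
  then show ?thesis using assms by simp
qed

lemma rep_eq_subst:
  assumes "g \<in> carrier_mat n n" "mat_inverse g = Some h"
  shows "rep g = subst_mpoly (\<lambda>i. \<Sum>j<n. const_mpoly (h $$ (i, j)) * var_mpoly j)"
  using assms by (simp add: rep_def)

text \<open>The Lie algebra acts by the differential operator with terms
  \<open>- A $$ (i, j)\<close> times \<open>x_j\<close> times the partial derivative in
  \<open>x_i\<close>. Hence the entry \<open>(i, j)\<close> moves an exponent by the root
  \<open>e_j - e_i\<close>, which is where freeness will enter.\<close>

lemma lie_rep_formula:
  assumes A: "A \<in> carrier_mat n n" and S: "finite S" "Poly_Mapping.keys p \<subseteq> S"
    and n: "\<And>a. a \<in> S \<Longrightarrow> Poly_Mapping.keys a \<subseteq> {..<n}"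
  shows "lie_rep A p = (\<Sum>a\<in>S. \<Sum>i\<in>Poly_Mapping.keys a. \<Sum>j<n.
     const_mpoly (- Poly_Mapping.lookup p a * of_nat (Poly_Mapping.lookup a i) * A $$ (i, j)) *
     xpow (a - Poly_Mapping.single i 1 + Poly_Mapping.single j 1))"
proof -
  define f where "f = (\<lambda>i t. \<Sum>j<n. const_mpoly (mat_exp ((- complex_of_real t) \<cdot>\<^sub>m A) $$ (i, j)) * var_mpoly j)"
  define f' where "f' = (\<lambda>i. \<Sum>j<n. const_mpoly (- A $$ (i, j)) * var_mpoly j)"
  have rep: "rep (mat_exp (complex_of_real t \<cdot>\<^sub>m A)) p = (\<Sum>a\<in>S. const_mpoly (Poly_Mapping.lookup p a) *
     (\<Prod>i\<in>Poly_Mapping.keys a. f i t ^ Poly_Mapping.lookup a i))" for t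
    using A unfolding f_def
    by (subst rep_eq_subst[of _ n, OF mat_exp_carrier mat_inverse_mat_exp[OF A]])
       (auto simp: subst_mpoly_supset[OF S])
  have f': "(f i has_vector_derivative f' i) (at 0)" if "i < n" for i
    unfolding f_def f'_def
  proof (rule has_vector_derivative_sum)
    fix j assume "j \<in> {..<n}"
    then have j: "j < n" by simp
    show "((\<lambda>t. const_mpoly (mat_exp ((- complex_of_real t) \<cdot>\<^sub>m A) $$ (i, j)) * var_mpoly j)
       has_vector_derivative const_mpoly (- A $$ (i, j)) * var_mpoly j) (at 0)"
      by (intro bounded_linear.has_vector_derivative[OF bounded_bilinear.bounded_linear_left[OF bounded_bilinear_mult_mpoly]]
          bounded_linear.has_vector_derivative[OF bounded_linear_const_mpoly]
          mat_exp_has_vector_derivative[OF A that j])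
  qed
  have f0: "f i 0 = var_mpoly i" if "i < n" for i
    using subst_var_mpoly_one[OF that] mat_exp_zero[OF A] by (simp add: f_def)
  have "((\<lambda>t. rep (mat_exp (complex_of_real t \<cdot>\<^sub>m A)) p) has_vector_derivative
    (\<Sum>a\<in>S. const_mpoly (Poly_Mapping.lookup p a) *
      (\<Sum>i\<in>Poly_Mapping.keys a. of_nat (Poly_Mapping.lookup a i) * f' i * xpow (a - Poly_Mapping.single i 1)))) (at 0)"
    unfolding rep
    by (intro has_vector_derivative_sum
          bounded_linear.has_vector_derivative[OF bounded_bilinear.bounded_linear_right[OF bounded_bilinear_mult_mpoly]]
          subst_monomial_derivative f' f0) (use n in \<open>auto simp: subset_iff\<close>)
  then have "lie_rep A p = (\<Sum>a\<in>S. const_mpoly (Poly_Mapping.lookup p a) *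
      (\<Sum>i\<in>Poly_Mapping.keys a. of_nat (Poly_Mapping.lookup a i) * f' i * xpow (a - Poly_Mapping.single i 1)))"
    unfolding lie_rep_def by (rule vector_derivative_at)
  also have "\<dots> = (\<Sum>a\<in>S. \<Sum>i\<in>Poly_Mapping.keys a. \<Sum>j<n.
     const_mpoly (- Poly_Mapping.lookup p a * of_nat (Poly_Mapping.lookup a i) * A $$ (i, j)) *
     xpow (a - Poly_Mapping.single i 1 + Poly_Mapping.single j 1))"
    unfolding f'_def sum_distrib_left sum_distrib_right
    by (intro sum.cong refl)
       (simp add: var_mpoly_def const_mpoly_def mult_single single_of_nat[symmetric] mult_ac add_ac
          del: single_of_nat)
  finally show ?thesis .
qed

subsection \<open>The diagonal torus\<close>

definition diagm :: "nat \<Rightarrow> (nat \<Rightarrow> complex) \<Rightarrow> complex mat" where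
  "diagm n z = mat n n (\<lambda>(i, j). if i = j then z i else 0)"

lemma diagm_carrier [simp]: "diagm n z \<in> carrier_mat n n"
  by (simp add: diagm_def)

lemma diagm_mult: "diagm n z * diagm n w = diagm n (\<lambda>i. z i * w i)"
  by (rule eq_matI)
     (auto simp: diagm_def scalar_prod_def if_distrib[of "\<lambda>x. x * _"] if_distrib[of "\<lambda>x. _ * x"] cong: if_cong)

lemma mat_inverse_diagm:
  assumes "\<And>i. i < n \<Longrightarrow> z i \<noteq> 0"
  shows "mat_inverse (diagm n z) = Some (diagm n (\<lambda>i. inverse (z i)))"
proof (rule mat_inverse_eqI[where n = n])
  show "diagm n z * diagm n (\<lambda>i. inverse (z i)) = 1\<^sub>m n" "diagm n (\<lambda>i. inverse (z i)) * diagm n z = 1\<^sub>m n"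
    unfolding diagm_mult using assms by (auto simp: diagm_def)
qed auto

lemma det_diagm: "Determinant.det (diagm n z) = (\<Prod>i<n. z i)"
proof -
  have "Determinant.det (diagm n z) = prod_list (diag_mat (diagm n z))"
    by (rule det_upper_triangular[of _ n]) (auto simp: diagm_def)
  also have "diag_mat (diagm n z) = map z [0..<n]"
    by (auto simp: diag_mat_def diagm_def)
  also have "prod_list (map z [0..<n]) = (\<Prod>i<n. z i)"
    by (simp add: prod.distinct_set_conv_list[symmetric] atLeast0LessThan)
  finally show ?thesis .
qed

lemma mat_adjoint_index:
  assumes "A \<in> carrier_mat n n" "i < n" "j < n"
  shows "mat_adjoint A $$ (i, j) = cnj (A $$ (j, i))"
  using assms by (simp add: mat_adjoint_def mat_of_rows_def)

lemma mat_adjoint_carrier: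
  assumes "A \<in> carrier_mat n n"
  shows "mat_adjoint A \<in> carrier_mat n n"
  using assms by (auto simp: mat_adjoint_def)

lemma mat_adjoint_diagm: "mat_adjoint (diagm n z) = diagm n (\<lambda>i. cnj (z i))"
proof (rule eq_matI)
  fix i j assume "i < dim_row (diagm n (\<lambda>i. cnj (z i)))" "j < dim_col (diagm n (\<lambda>i. cnj (z i)))"
  then show "mat_adjoint (diagm n z) $$ (i, j) = diagm n (\<lambda>i. cnj (z i)) $$ (i, j)"
    by (subst mat_adjoint_index[of _ n]) (auto simp: diagm_def)
qed (use mat_adjoint_carrier[OF diagm_carrier[of n z]] in \<open>auto simp: diagm_def\<close>)

lemma diagm_SL: "(\<Prod>i<n. z i) = 1 \<Longrightarrow> diagm n z \<in> SL n"
  by (simp add: SL_def det_diagm)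

lemma diagm_SU:
  assumes "(\<Prod>i<n. z i) = 1" "\<And>i. i < n \<Longrightarrow> cmod (z i) = 1"
  shows "diagm n z \<in> SU n"
  using assms
  by (auto simp: SU_def diagm_SL mat_adjoint_diagm diagm_mult complex_norm_square[symmetric])
     (auto simp: diagm_def)

text \<open>Monomials are weight vectors of the diagonal torus: replacing each \<open>x_i\<close> by
  \<open>inverse (z i)\<close> times \<open>x_i\<close> multiplies a monomial by the inverse of its
  character.\<close>

lemma rep_diagm:
  assumes z: "\<And>i. i < n \<Longrightarrow> z i \<noteq> 0" and S: "finite S" "Poly_Mapping.keys p \<subseteq> S"
    and n: "\<And>a. a \<in> S \<Longrightarrow> Poly_Mapping.keys a \<subseteq> {..<n}"
  shows "rep (diagm n z) p = (\<Sum>a\<in>S. Poly_Mapping.single a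
     (Poly_Mapping.lookup p a * (\<Prod>i<n. inverse (z i) ^ Poly_Mapping.lookup a i)))"
proof -
  define f where "f = (\<lambda>i. \<Sum>j<n. const_mpoly (diagm n (\<lambda>i. inverse (z i)) $$ (i, j)) * var_mpoly j)"
  have f: "f i = const_mpoly (inverse (z i)) * var_mpoly i" if "i < n" for i
  proof -
    have "f i = (\<Sum>j<n. if i = j then const_mpoly (inverse (z i)) * var_mpoly j else 0)"
      unfolding f_def using that by (intro sum.cong) (auto simp: diagm_def)
    then show ?thesis using that by simp
  qed
  have "rep (diagm n z) p = subst_mpoly f p"
    unfolding f_def by (subst rep_eq_subst[OF diagm_carrier mat_inverse_diagm]) (use z in auto)
  also have "\<dots> = (\<Sum>a\<in>S. const_mpoly (Poly_Mapping.lookup p a) *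
     (\<Prod>i\<in>Poly_Mapping.keys a. f i ^ Poly_Mapping.lookup a i))"
    by (rule subst_mpoly_supset[OF S])
  also have "\<dots> = (\<Sum>a\<in>S. Poly_Mapping.single a
     (Poly_Mapping.lookup p a * (\<Prod>i<n. inverse (z i) ^ Poly_Mapping.lookup a i)))"
  proof (rule sum.cong[OF refl])
    fix a assume a: "a \<in> S"
    have "(\<Prod>i\<in>Poly_Mapping.keys a. f i ^ Poly_Mapping.lookup a i)
        = (\<Prod>i\<in>Poly_Mapping.keys a. const_mpoly (inverse (z i) ^ Poly_Mapping.lookup a i)
            * var_mpoly i ^ Poly_Mapping.lookup a i)"
      using n[OF a] by (intro prod.cong) (auto simp: f power_mult_distrib const_mpoly_power subset_iff)
    also have "\<dots> = const_mpoly (\<Prod>i\<in>Poly_Mapping.keys a. inverse (z i) ^ Poly_Mapping.lookup a i)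
        * xpow (\<Sum>i\<in>Poly_Mapping.keys a. Poly_Mapping.single i (Poly_Mapping.lookup a i))"
      by (simp add: prod.distrib const_mpoly_prod prod_var_mpoly_power)
    also have "(\<Sum>i\<in>Poly_Mapping.keys a. Poly_Mapping.single i (Poly_Mapping.lookup a i)) = a"
      by (rule poly_mapping_sum_single[symmetric]) auto
    also have "(\<Prod>i\<in>Poly_Mapping.keys a. inverse (z i) ^ Poly_Mapping.lookup a i)
        = (\<Prod>i<n. inverse (z i) ^ Poly_Mapping.lookup a i)"
      using n[OF a] by (intro prod.mono_neutral_left) (auto simp: in_keys_iff)
    finally show "const_mpoly (Poly_Mapping.lookup p a) *
        (\<Prod>i\<in>Poly_Mapping.keys a. f i ^ Poly_Mapping.lookup a i)
      = Poly_Mapping.single a (Poly_Mapping.lookup p a * (\<Prod>i<n. inverse (z i) ^ Poly_Mapping.lookup a i))"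
      by (simp add: const_mpoly_mult_single)
  qed
  finally show ?thesis .
qed

lemma rep_diagm_single:
  assumes z: "\<And>i. i < n \<Longrightarrow> z i \<noteq> 0" and n: "Poly_Mapping.keys a \<subseteq> {..<n}"
  shows "rep (diagm n z) (xpow a) = const_mpoly (\<Prod>i<n. inverse (z i) ^ Poly_Mapping.lookup a i) * xpow a"
  using rep_diagm[of n z "{a}" "xpow a"] assms by (simp add: const_mpoly_mult_single)

text \<open>Because of the inverse in the action, the element with diagonal
  \<open>exp (t * y i)\<close> scales every monomial of \<open>v\<close> by
  \<open>exp (- t)\<close>, so the pairing value \<open>1\<close> yields decay as \<open>t\<close>
  grows. The vanishing sum of \<open>y\<close> makes the determinant \<open>1\<close>.\<close>

lemma unstable_if_weight_functional:
  assumes n: "\<And>a. a \<in> Poly_Mapping.keys v \<Longrightarrow> Poly_Mapping.keys a \<subseteq> {..<n}"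
    and y0: "(\<Sum>i<n. y i) = (0::real)"
    and y1: "\<And>a. a \<in> Poly_Mapping.keys v \<Longrightarrow> (\<Sum>i<n. y i * real (Poly_Mapping.lookup a i)) = 1"
  shows "unstable n v"
proof -
  have eq: "rep (diagm n (\<lambda>i. of_real (exp (t * y i)))) v = exp (- t) *\<^sub>R v" for t
  proof -
    let ?S = "Poly_Mapping.keys v"
    have "rep (diagm n (\<lambda>i. of_real (exp (t * y i)))) v = (\<Sum>a\<in>?S. Poly_Mapping.single a
       (Poly_Mapping.lookup v a * (\<Prod>i<n. inverse (complex_of_real (exp (t * y i))) ^ Poly_Mapping.lookup a i)))"
      by (rule rep_diagm) (use n in auto)
    also have "\<dots> = (\<Sum>a\<in>?S. const_mpoly (of_real (exp (- t))) * Poly_Mapping.single a (Poly_Mapping.lookup v a))"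
    proof (rule sum.cong[OF refl])
      fix a assume a: "a \<in> ?S"
      have "(\<Prod>i<n. inverse (exp (t * y i)) ^ Poly_Mapping.lookup a i)
          = (\<Prod>i<n. exp (- t * (y i * real (Poly_Mapping.lookup a i))))"
        by (intro prod.cong) (auto simp: exp_minus[symmetric] exp_of_nat_mult[symmetric] mult_ac)
      also have "\<dots> = exp (- t * (\<Sum>i<n. y i * real (Poly_Mapping.lookup a i)))"
        by (simp add: exp_sum sum_distrib_left)
      finally have "(\<Prod>i<n. inverse (complex_of_real (exp (t * y i))) ^ Poly_Mapping.lookup a i)
          = of_real (exp (- t))"
        using y1[OF a] by (simp flip: of_real_inverse of_real_power of_real_prod)
      then show "Poly_Mapping.single a (Poly_Mapping.lookup v a *
          (\<Prod>i<n. inverse (complex_of_real (exp (t * y i))) ^ Poly_Mapping.lookup a i))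
        = const_mpoly (of_real (exp (- t))) * Poly_Mapping.single a (Poly_Mapping.lookup v a)"
        by (simp add: const_mpoly_mult_single mult_ac)
    qed
    also have "\<dots> = const_mpoly (of_real (exp (- t))) * v"
      using poly_mapping_sum_single[of ?S v] by (simp flip: sum_distrib_left)
    finally show ?thesis by (simp add: scaleR_mpoly)
  qed
  have "exp (- t) *\<^sub>R v \<in> (\<lambda>g. rep g v) ` SL n" for t
  proof -
    have "(\<Prod>i<n. exp (t * y i)) = 1"
      using y0 by (simp flip: exp_sum sum_distrib_left)
    then have "(\<Prod>i<n. complex_of_real (exp (t * y i))) = 1"
      by (simp flip: of_real_prod)
    then have "diagm n (\<lambda>i. of_real (exp (t * y i))) \<in> SL n" by (rule diagm_SL)
    then show ?thesis using eq[of t] by (metis imageI)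
  qed
  moreover have "(\<lambda>k. exp (- real k) *\<^sub>R v) \<longlonglongrightarrow> 0 *\<^sub>R v"
    by (intro tendsto_scaleR tendsto_const)
       (auto intro!: filterlim_compose[OF exp_at_bot] filterlim_compose[OF filterlim_uminus_at_bot_at_top]
          filterlim_real_sequentially)
  ultimately show ?thesis
    unfolding unstable_def closure_sequential by (intro exI[of _ "\<lambda>k. exp (- real k) *\<^sub>R v"]) auto
qed

subsection \<open>Invariant inner products and the moment map\<close>

definition exponents :: "nat \<Rightarrow> nat \<Rightarrow> (nat \<Rightarrow>\<^sub>0 nat) set" where
  "exponents n d = {a. Poly_Mapping.keys a \<subseteq> {..<n} \<and> (\<Sum>i<n. Poly_Mapping.lookup a i) = d}"

lemma forms_iff: "p \<in> forms n d \<longleftrightarrow> Poly_Mapping.keys p \<subseteq> exponents n d"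
  by (auto simp: forms_def exponents_def)

lemma zero_in_forms: "0 \<in> forms n d"
  by (simp add: forms_iff)

lemma add_in_forms: "p \<in> forms n d \<Longrightarrow> q \<in> forms n d \<Longrightarrow> p + q \<in> forms n d"
  using keys_add[of p q] by (auto simp: forms_iff)

lemma sum_in_forms: "(\<And>x. x \<in> I \<Longrightarrow> f x \<in> forms n d) \<Longrightarrow> sum f I \<in> forms n d"
  by (induction I rule: infinite_finite_induct) (auto simp: zero_in_forms add_in_forms)

lemma single_in_forms: "a \<in> exponents n d \<Longrightarrow> Poly_Mapping.single a c \<in> forms n d"
  by (auto simp: forms_iff)

text \<open>Equal total degree rules out that one exponent dominates the other. The two opposite
  strict inequalities allow a torus element of determinant \<open>1\<close> that turns two
  coordinates in opposite directions.\<close>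

lemma exponents_distinct:
  assumes "a \<in> exponents n d" "b \<in> exponents n d" "a \<noteq> b"
  obtains i j where "i < n" "j < n" "Poly_Mapping.lookup a i > Poly_Mapping.lookup b i"
    "Poly_Mapping.lookup a j < Poly_Mapping.lookup b j"
proof -
  have ex: "\<exists>i<n. Poly_Mapping.lookup a i > Poly_Mapping.lookup b i"
    if ab: "a \<in> exponents n d" "b \<in> exponents n d" "a \<noteq> b" for a b
  proof (rule ccontr)
    assume "\<not> ?thesis"
    then have le: "Poly_Mapping.lookup a i \<le> Poly_Mapping.lookup b i" if "i < n" for i
      using that by (meson not_less)
    obtain k where k: "Poly_Mapping.lookup a k \<noteq> Poly_Mapping.lookup b k"
      using ab(3) by (metis poly_mapping_eqI)
    then have "k \<in> Poly_Mapping.keys a \<union> Poly_Mapping.keys b" by (auto simp: in_keys_iff)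
    then have "k < n" using ab by (auto simp: exponents_def)
    then have "(\<Sum>i<n. Poly_Mapping.lookup a i) < (\<Sum>i<n. Poly_Mapping.lookup b i)"
      using le k by (intro sum_strict_mono_ex1) (auto intro!: bexI[of _ k] simp: order_less_le)
    then show False using ab by (simp add: exponents_def)
  qed
  from ex[OF assms] ex[OF assms(2,1) assms(3)[symmetric]] that show ?thesis by blast
qed

context
  fixes n d ip
  assumes inv: "SU_invariant_inner n d ip"
begin

lemma ip_cnj: "p \<in> forms n d \<Longrightarrow> q \<in> forms n d \<Longrightarrow> ip q p = cnj (ip p q)"
  using inv unfolding SU_invariant_inner_def by blast

lemma ip_add: "p \<in> forms n d \<Longrightarrow> q \<in> forms n d \<Longrightarrow> r \<in> forms n d \<Longrightarrow> ip p (q + r) = ip p q + ip p r"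
  using inv unfolding SU_invariant_inner_def by blast

lemma ip_scale: "p \<in> forms n d \<Longrightarrow> q \<in> forms n d \<Longrightarrow> ip p (const_mpoly c * q) = c * ip p q"
  using inv unfolding SU_invariant_inner_def by blast

lemma ip_pos: "p \<in> forms n d \<Longrightarrow> p \<noteq> 0 \<Longrightarrow> Re (ip p p) > 0"
  using inv unfolding SU_invariant_inner_def by blast

lemma ip_rep: "g \<in> SU n \<Longrightarrow> p \<in> forms n d \<Longrightarrow> q \<in> forms n d \<Longrightarrow> ip (rep g p) (rep g q) = ip p q"
  using inv unfolding SU_invariant_inner_def by blast

lemma ip_zero: "p \<in> forms n d \<Longrightarrow> ip p 0 = 0"
  using ip_scale[of p 0 0] zero_in_forms by simp

lemma ip_sum:
  assumes "p \<in> forms n d" "\<And>x. x \<in> I \<Longrightarrow> f x \<in> forms n d"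
  shows "ip p (sum f I) = (\<Sum>x\<in>I. ip p (f x))"
  using assms(2)
  by (induction I rule: infinite_finite_induct)
     (auto simp: ip_zero[OF assms(1)] ip_add[OF assms(1)] sum_in_forms)

lemma ip_sum_left:
  assumes "p \<in> forms n d" "\<And>x. x \<in> I \<Longrightarrow> f x \<in> forms n d"
  shows "ip (sum f I) p = (\<Sum>x\<in>I. ip (f x) p)"
proof -
  have "ip (sum f I) p = cnj (ip p (sum f I))"
    using assms by (intro ip_cnj) (auto intro: sum_in_forms)
  also have "\<dots> = (\<Sum>x\<in>I. cnj (ip p (f x)))" using assms by (simp add: ip_sum)
  also have "\<dots> = (\<Sum>x\<in>I. ip (f x) p)" using assms by (intro sum.cong) (auto simp: ip_cnj[of p])
  finally show ?thesis .
qed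

lemma ip_scale_left:
  assumes "p \<in> forms n d" "q \<in> forms n d" "const_mpoly c * q \<in> forms n d"
  shows "ip (const_mpoly c * q) p = cnj c * ip q p"
  using ip_cnj[OF assms(1,3)] ip_cnj[OF assms(1,2)] ip_scale[OF assms(1,2), of c] by simp

text \<open>A torus element of \<open>SU(n)\<close> that acts on the two monomials by scalars with quotient \<open>-1\<close>.\<close>

lemma ip_monomials_orthogonal:
  assumes a: "a \<in> exponents n d" and b: "b \<in> exponents n d" and ab: "a \<noteq> b"
  shows "ip (xpow a) (xpow b) = 0"
proof -
  obtain i j where ij: "i < n" "j < n" "Poly_Mapping.lookup a i > Poly_Mapping.lookup b i"
    "Poly_Mapping.lookup a j < Poly_Mapping.lookup b j"
    using exponents_distinct[OF a b ab] by blast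
  then have ne: "i \<noteq> j" by auto
  \<comment> \<open>The two bracketed differences are positive, so the denominator is nonzero; the
    relative phase of the two monomials becomes exactly \<pi>. Opposite angles in coordinates
    \<open>i\<close> and \<open>j\<close> keep the determinant equal to \<open>1\<close>.\<close>
  define \<theta> where "\<theta> = pi / ((real (Poly_Mapping.lookup a i) - real (Poly_Mapping.lookup b i)) +
      (real (Poly_Mapping.lookup b j) - real (Poly_Mapping.lookup a j)))"
  define z where "z = (\<lambda>k. if k = i then cis \<theta> else if k = j then cis (- \<theta>) else 1)"
  have prod: "(\<Prod>k<n. if k = i then u else if k = j then v else 1) = u * v" for u v :: complex
  proof -
    have "(\<Prod>k<n. if k = i then u else if k = j then v else 1) =
       (\<Prod>k\<in>{i, j}. if k = i then u else if k = j then v else 1)"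
      using ij by (intro prod.mono_neutral_right) auto
    then show ?thesis using ne by simp
  qed
  have SU: "diagm n z \<in> SU n"
    by (rule diagm_SU) (auto simp: z_def prod cis_mult)
  have act: "rep (diagm n z) (xpow e) = const_mpoly (cis (- \<theta> * (real (Poly_Mapping.lookup e i) -
      real (Poly_Mapping.lookup e j)))) * xpow e" if e: "e \<in> exponents n d" for e
  proof -
    have "rep (diagm n z) (xpow e) = const_mpoly (\<Prod>k<n. inverse (z k) ^ Poly_Mapping.lookup e k) * xpow e"
      using e by (intro rep_diagm_single) (auto simp: z_def exponents_def)
    also have "(\<Prod>k<n. inverse (z k) ^ Poly_Mapping.lookup e k) =
       (\<Prod>k<n. if k = i then cis (- \<theta>) ^ Poly_Mapping.lookup e i
          else if k = j then cis \<theta> ^ Poly_Mapping.lookup e j else 1)"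
      by (intro prod.cong) (auto simp: z_def)
    also have "\<dots> = cis (- \<theta> * (real (Poly_Mapping.lookup e i) - real (Poly_Mapping.lookup e j)))"
      by (simp add: prod DeMoivre cis_mult algebra_simps)
    finally show ?thesis .
  qed
  let ?\<alpha> = "cis (- \<theta> * (real (Poly_Mapping.lookup a i) - real (Poly_Mapping.lookup a j)))"
  let ?\<beta> = "cis (- \<theta> * (real (Poly_Mapping.lookup b i) - real (Poly_Mapping.lookup b j)))"
  have fa: "const_mpoly c * xpow a \<in> forms n d" "xpow a \<in> forms n d" for c
    using a by (auto simp: const_mpoly_mult_single single_in_forms)
  have fb: "const_mpoly c * xpow b \<in> forms n d" "xpow b \<in> forms n d" for c
    using b by (auto simp: const_mpoly_mult_single single_in_forms)
  have "ip (xpow a) (xpow b) = ip (const_mpoly ?\<alpha> * xpow a) (const_mpoly ?\<beta> * xpow b)"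
    using ip_rep[OF SU fa(2) fb(2)] act[OF a] act[OF b] by simp
  also have "\<dots> = cnj ?\<alpha> * ?\<beta> * ip (xpow a) (xpow b)"
    using ip_scale_left[OF fb(1) fa(2) fa(1)] ip_scale[OF fa(2) fb(2)] by simp
  also have "cnj ?\<alpha> * ?\<beta> = cis (\<theta> * ((real (Poly_Mapping.lookup a i) - real (Poly_Mapping.lookup b i)) +
      (real (Poly_Mapping.lookup b j) - real (Poly_Mapping.lookup a j))))"
    by (simp add: cis_cnj cis_mult algebra_simps)
  also have "\<dots> = -1" using ij unfolding \<theta>_def by simp
  finally show ?thesis by simp
qed

lemma ip_monomial_self:
  assumes "a \<in> exponents n d"
  shows "ip (xpow a) (xpow a) = of_real (Re (ip (xpow a) (xpow a)))" "Re (ip (xpow a) (xpow a)) > 0"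
proof -
  have f: "xpow a \<in> forms n d" using assms by (rule single_in_forms)
  show "Re (ip (xpow a) (xpow a)) > 0" using ip_pos[OF f] by (simp flip: keys_eq_empty)
  show "ip (xpow a) (xpow a) = of_real (Re (ip (xpow a) (xpow a)))"
    using ip_cnj[OF f f] by (simp add: complex_eq_iff)
qed

end

text \<open>Testing with \<open>A = H - K\<close> turns the difference of the two traces into the
  squared Frobenius norm of \<open>H - K\<close>. This is the uniqueness behind the definite
  description in \<open>moment_map\<close>.\<close>

lemma traceless_hermitian_eqI:
  assumes H: "H \<in> traceless_hermitian n" and K: "K \<in> traceless_hermitian n"
    and eq: "\<And>A. A \<in> traceless_hermitian n \<Longrightarrow> mat_trace (H * A) = mat_trace (K * A)"
  shows "H = K"
proof -
  have c: "H \<in> carrier_mat n n" "K \<in> carrier_mat n n" using H K by (auto simp: traceless_hermitian_def)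
  have herm: "cnj (H $$ (j, i)) = H $$ (i, j)" "cnj (K $$ (j, i)) = K $$ (i, j)" if "i < n" "j < n" for i j
    using H K mat_adjoint_index[of H n i j] mat_adjoint_index[of K n i j] that
    by (auto simp: traceless_hermitian_def)
  have D: "H - K \<in> traceless_hermitian n"
  proof -
    have "mat_adjoint (H - K) = H - K"
    proof (rule eq_matI)
      fix i j assume "i < dim_row (H - K)" "j < dim_col (H - K)"
      then have ij: "i < n" "j < n" using c by auto
      then show "mat_adjoint (H - K) $$ (i, j) = (H - K) $$ (i, j)"
        using c herm[OF ij] by (subst mat_adjoint_index[of _ n]) auto
    qed (use c mat_adjoint_carrier[OF minus_carrier_mat[OF c(2)], of H] in auto)
    then show ?thesis
      using H K c by (auto simp: traceless_hermitian_def mat_trace_def sum_subtractf)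
  qed
  have tr: "mat_trace (X * (H - K)) = (\<Sum>i<n. \<Sum>j<n. X $$ (i, j) * (H - K) $$ (j, i))"
    if "X \<in> carrier_mat n n" for X
    using that c by (simp add: mat_trace_def scalar_prod_def atLeast0LessThan)
  have "0 = mat_trace (H * (H - K)) - mat_trace (K * (H - K))" using eq[OF D] by simp
  also have "\<dots> = (\<Sum>i<n. \<Sum>j<n. (H $$ (i, j) - K $$ (i, j)) * (H $$ (j, i) - K $$ (j, i)))"
    unfolding tr[OF c(1)] tr[OF c(2)] sum_subtractf[symmetric] left_diff_distrib[symmetric]
    using c by (intro sum.cong refl) auto
  also have "\<dots> = (\<Sum>i<n. \<Sum>j<n. of_real ((cmod (H $$ (i, j) - K $$ (i, j)))\<^sup>2))"
    by (intro sum.cong refl) (auto simp: complex_norm_square herm simp del: of_real_power)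
  also have "\<dots> = of_real (\<Sum>i<n. \<Sum>j<n. (cmod (H $$ (i, j) - K $$ (i, j)))\<^sup>2)" by simp
  finally have "complex_of_real (\<Sum>i<n. \<Sum>j<n. (cmod (H $$ (i, j) - K $$ (i, j)))\<^sup>2) = 0"
    by (rule sym)
  then have "(\<Sum>i<n. \<Sum>j<n. (cmod (H $$ (i, j) - K $$ (i, j)))\<^sup>2) = 0"
    by (simp only: of_real_eq_0_iff)
  then have "H $$ (i, j) = K $$ (i, j)" if "i < n" "j < n" for i j
    using that by (auto simp: sum_nonneg_eq_0_iff sum_nonneg)
  then show ?thesis using c by (intro eq_matI) auto
qed

lemma moment_map_eqI:
  assumes "H \<in> traceless_hermitian n"
    and "\<And>A. A \<in> traceless_hermitian n \<Longrightarrow> mat_trace (H * A) = ip v (lie_rep A v) / ip v v"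
  shows "moment_map n ip v = H"
  unfolding moment_map_def
proof (rule the_equality)
  fix K assume "K \<in> traceless_hermitian n \<and>
     (\<forall>A\<in>traceless_hermitian n. mat_trace (K * A) = ip v (lie_rep A v) / ip v v)"
  then show "K = H" using assms by (intro traceless_hermitian_eqI[of K n H]) auto
qed (use assms in auto)

lemma lookup_sum_single:
  assumes "finite S"
  shows "Poly_Mapping.lookup (\<Sum>a\<in>S. Poly_Mapping.single a (c a)) b = (if b \<in> S then c b else 0)"
  using assms by (simp add: lookup_sum lookup_single when_def)

lemma keys_sum_single:
  assumes "finite S"
  shows "Poly_Mapping.keys (\<Sum>a\<in>S. Poly_Mapping.single a (c a)) \<subseteq> S"
  using lookup_sum_single[OF assms, of c] by (auto simp: in_keys_iff split: if_splits)

text \<open>No two elements differ by a root \<open>e\<^sub>i - e\<^sub>j\<close>, stated without subtraction.\<close>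

definition free_weights :: "nat \<Rightarrow> (nat \<Rightarrow>\<^sub>0 nat) set \<Rightarrow> bool" where
  "free_weights n S \<longleftrightarrow> (\<forall>a\<in>S. \<forall>b\<in>S. \<forall>i<n. \<forall>j<n.
     a + Poly_Mapping.single i 1 = b + Poly_Mapping.single j 1 \<longrightarrow> a = b)"

section \<open>Moment maps of forms supported on a free set of monomials\<close>

context
  fixes n d ip S and c :: "(nat \<Rightarrow>\<^sub>0 nat) \<Rightarrow> real" and v :: mpoly and lam :: "(nat \<Rightarrow>\<^sub>0 nat) \<Rightarrow> real"
  assumes inv: "SU_invariant_inner n d ip"
    and fin: "finite S" and S: "S \<subseteq> exponents n d" and free: "free_weights n S"
    and v_def: "v = (\<Sum>a\<in>S. Poly_Mapping.single a (of_real (c a)))"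
    and lam: "\<And>a. a \<in> S \<Longrightarrow> lam a = (c a)\<^sup>2 * Re (ip (xpow a) (xpow a))"
    and lam1: "(\<Sum>a\<in>S. lam a) = 1"
begin

lemma free_form: "v \<in> forms n d"
  unfolding v_def using S by (intro sum_in_forms single_in_forms) auto

lemma ip_free_form_xpow:
  assumes b: "b \<in> exponents n d"
  shows "ip v (xpow b) = (if b \<in> S then of_real (c b * Re (ip (xpow b) (xpow b))) else 0)"
proof -
  have "ip v (xpow b) = (\<Sum>a\<in>S. ip (Poly_Mapping.single a (of_real (c a))) (xpow b))"
    unfolding v_def using S b by (intro ip_sum_left[OF inv] single_in_forms) auto
  also have "\<dots> = (\<Sum>a\<in>S. if a = b then of_real (c b * Re (ip (xpow b) (xpow b))) else 0)"
  proof (rule sum.cong[OF refl])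
    fix a assume a: "a \<in> S"
    then have a': "a \<in> exponents n d" using S by auto
    have "Poly_Mapping.single a (of_real (c a)) = const_mpoly (of_real (c a)) * xpow a"
      by (simp add: const_mpoly_mult_single)
    then have "ip (Poly_Mapping.single a (of_real (c a))) (xpow b) = of_real (c a) * ip (xpow a) (xpow b)"
      using a' b ip_scale_left[OF inv, of "xpow b" "xpow a" "of_real (c a)"] single_in_forms[OF a', of "of_real (c a)"]
      by (simp add: single_in_forms)
    also have "\<dots> = (if a = b then of_real (c b * Re (ip (xpow b) (xpow b))) else 0)"
      using ip_monomials_orthogonal[OF inv a' b] ip_monomial_self(1)[OF inv b] by auto
    finally show "ip (Poly_Mapping.single a (of_real (c a))) (xpow b) =
        (if a = b then of_real (c b * Re (ip (xpow b) (xpow b))) else 0)" .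
  qed
  also have "\<dots> = (if b \<in> S then of_real (c b * Re (ip (xpow b) (xpow b))) else 0)"
    using fin by simp
  finally show ?thesis .
qed

lemma ip_free_form_self: "ip v v = 1"
proof -
  have "ip v v = (\<Sum>a\<in>S. ip v (Poly_Mapping.single a (of_real (c a))))"
    by (subst (2) v_def) (use S in \<open>intro ip_sum[OF inv free_form] single_in_forms, auto\<close>)
  also have "\<dots> = (\<Sum>a\<in>S. of_real (lam a))"
  proof (rule sum.cong[OF refl])
    fix a assume a: "a \<in> S"
    then have a': "a \<in> exponents n d" using S by auto
    have "Poly_Mapping.single a (of_real (c a)) = const_mpoly (of_real (c a)) * xpow a"
      by (simp add: const_mpoly_mult_single)
    then show "ip v (Poly_Mapping.single a (of_real (c a))) = of_real (lam a)"
      using ip_scale[OF inv free_form single_in_forms[OF a'], of "of_real (c a)"] a a'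
      by (simp add: ip_free_form_xpow lam power2_eq_square)
  qed
  finally show ?thesis using lam1 by (simp flip: of_real_sum)
qed

text \<open>The entry \<open>(i, j)\<close> of \<open>A\<close> sends the exponent \<open>a\<close>
  to \<open>a - e_i + e_j\<close>. By freeness this lies in \<open>S\<close> only if it equals
  \<open>a\<close>, that is, if \<open>i = j\<close>; otherwise the result is orthogonal to every
  monomial of \<open>v\<close>. The diagonal terms return \<open>a\<close> with multiplicity
  \<open>lookup a i\<close>.\<close>

lemma ip_lie_rep_free_form:
  assumes A: "A \<in> carrier_mat n n"
  shows "ip v (lie_rep A v) = - (\<Sum>i<n. of_real (\<Sum>a\<in>S. lam a * real (Poly_Mapping.lookup a i)) * A $$ (i, i))"
proof -
  let ?T = "\<lambda>a i j. const_mpoly (- of_real (c a) * of_nat (Poly_Mapping.lookup a i) * A $$ (i, j)) *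
     xpow (a - Poly_Mapping.single i 1 + Poly_Mapping.single j 1)"
  \<comment> \<open>Truncated subtraction is harmless here because \<open>i\<close> lies in the
    support of \<open>a\<close>. The identity \<open>shift\<close> has the subtraction-free shape in
    which \<open>free_weights\<close> is stated.\<close>
  have exp: "a - Poly_Mapping.single i 1 + Poly_Mapping.single j 1 \<in> exponents n d"
    and shift: "a - Poly_Mapping.single i 1 + Poly_Mapping.single j 1 + Poly_Mapping.single i 1
       = a + Poly_Mapping.single j 1"
    if a: "a \<in> S" and i: "i \<in> Poly_Mapping.keys a" and j: "j < n" for a i j
  proof -
    show sh: "a - Poly_Mapping.single i 1 + Poly_Mapping.single j 1 + Poly_Mapping.single i 1
       = a + Poly_Mapping.single j 1" (is "?b + _ = _")
      using i by (intro poly_mapping_eqI) (auto simp: lookup_add lookup_minus lookup_single when_def in_keys_iff)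
    have a': "a \<in> exponents n d" using a S by auto
    have i': "i < n" using a' i by (auto simp: exponents_def)
    have single: "(\<Sum>k<n. Poly_Mapping.lookup (Poly_Mapping.single l (1::nat)) k) = 1" if "l < n" for l
      using that by (simp add: lookup_single when_def)
    have "(\<Sum>k<n. Poly_Mapping.lookup (?b + Poly_Mapping.single i 1) k)
        = (\<Sum>k<n. Poly_Mapping.lookup (a + Poly_Mapping.single j 1) k)"
      unfolding sh ..
    then have "(\<Sum>k<n. Poly_Mapping.lookup ?b k) = (\<Sum>k<n. Poly_Mapping.lookup a k)"
      using single[OF i'] single[OF j] by (simp add: lookup_add sum.distrib del: One_nat_def)
    moreover have "Poly_Mapping.keys ?b \<subseteq> {..<n}"
      using a' j i' by (auto simp: exponents_def subset_iff in_keys_iff lookup_add lookup_minus lookup_single when_def split: if_splits)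
    ultimately show "?b \<in> exponents n d" using a' by (simp add: exponents_def)
  qed
  have T: "?T a i j \<in> forms n d" if "a \<in> S" "i \<in> Poly_Mapping.keys a" "j < n" for a i j
    using exp[OF that] by (simp add: const_mpoly_mult_single single_in_forms)
  have ipT: "ip v (?T a i j) = (if i = j then - of_real (lam a * real (Poly_Mapping.lookup a i)) * A $$ (i, i) else 0)"
    if a: "a \<in> S" and i: "i \<in> Poly_Mapping.keys a" and j: "j < n" for a i j
  proof -
    let ?b = "a - Poly_Mapping.single i 1 + Poly_Mapping.single j 1"
    have i': "i < n" using a S i by (auto simp: exponents_def)
    have "ip v (?T a i j) = (- of_real (c a) * of_nat (Poly_Mapping.lookup a i) * A $$ (i, j)) * ip v (xpow ?b)"
      by (rule ip_scale[OF inv free_form single_in_forms[OF exp[OF a i j]]])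
    also have "ip v (xpow ?b) = (if i = j then of_real (c a * Re (ip (xpow a) (xpow a))) else 0)"
    proof (cases "?b \<in> S")
      case True
      then have b: "?b = a" using free shift[OF a i j] a i' j unfolding free_weights_def by metis
      then have "Poly_Mapping.single i (1::nat) = Poly_Mapping.single j 1" using shift[OF a i j] by simp
      then have "i = j" by (metis keys_single singleton_inject zero_neq_one)
      then show ?thesis using b a exp[OF a i j] by (simp add: ip_free_form_xpow)
    next
      case False
      have "i \<noteq> j"
      proof
        assume "i = j"
        then have "?b = a" using shift[OF a i j] by simp
        then show False using False a by simp
      qed
      then show ?thesis using False exp[OF a i j] by (simp add: ip_free_form_xpow)
    qed
    finally show ?thesis using lam[OF a] by (simp add: power2_eq_square)
  qed
  have "lie_rep A v = (\<Sum>a\<in>S. \<Sum>i\<in>Poly_Mapping.keys a. \<Sum>j<n. ?T a i j)"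
    using lie_rep_formula[OF A fin keys_sum_single[OF fin], of "\<lambda>a. of_real (c a)"] S fin
    unfolding v_def[symmetric]
    by (simp add: v_def lookup_sum_single exponents_def subset_iff cong: sum.cong)
  also have "ip v \<dots> = (\<Sum>a\<in>S. \<Sum>i\<in>Poly_Mapping.keys a. \<Sum>j<n. ip v (?T a i j))"
  proof -
    have 1: "ip v (\<Sum>j<n. ?T a i j) = (\<Sum>j<n. ip v (?T a i j))" if "a \<in> S" "i \<in> Poly_Mapping.keys a" for a i
      by (rule ip_sum[OF inv free_form]) (rule T, use that in auto)
    have 2: "ip v (\<Sum>i\<in>Poly_Mapping.keys a. \<Sum>j<n. ?T a i j)
        = (\<Sum>i\<in>Poly_Mapping.keys a. ip v (\<Sum>j<n. ?T a i j))" if "a \<in> S" for a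
      by (rule ip_sum[OF inv free_form]) (rule sum_in_forms, rule T, use that in auto)
    have "ip v (\<Sum>a\<in>S. \<Sum>i\<in>Poly_Mapping.keys a. \<Sum>j<n. ?T a i j)
        = (\<Sum>a\<in>S. ip v (\<Sum>i\<in>Poly_Mapping.keys a. \<Sum>j<n. ?T a i j))"
      by (rule ip_sum[OF inv free_form]) (rule sum_in_forms, rule sum_in_forms, rule T, auto)
    also have "\<dots> = (\<Sum>a\<in>S. \<Sum>i\<in>Poly_Mapping.keys a. \<Sum>j<n. ip v (?T a i j))"
      by (rule sum.cong[OF refl], subst 2, assumption, rule sum.cong[OF refl], rule 1)
    finally show ?thesis .
  qed
  also have "\<dots> = (\<Sum>a\<in>S. \<Sum>i\<in>Poly_Mapping.keys a. \<Sum>j<n.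
      if i = j then - of_real (lam a * real (Poly_Mapping.lookup a i)) * A $$ (i, i) else 0)"
    by (intro sum.cong refl ipT) auto
  also have "\<dots> = (\<Sum>a\<in>S. \<Sum>i\<in>Poly_Mapping.keys a. - of_real (lam a * real (Poly_Mapping.lookup a i)) * A $$ (i, i))"
    using S by (intro sum.cong refl) (auto simp: exponents_def)
  also have "\<dots> = (\<Sum>a\<in>S. \<Sum>i<n. - of_real (lam a * real (Poly_Mapping.lookup a i)) * A $$ (i, i))"
    using S by (intro sum.cong refl sum.mono_neutral_left) (auto simp: exponents_def in_keys_iff)
  also have "\<dots> = - (\<Sum>i<n. of_real (\<Sum>a\<in>S. lam a * real (Poly_Mapping.lookup a i)) * A $$ (i, i))"
    by (subst sum.swap) (simp add: sum_negf sum_distrib_right)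
  finally show ?thesis .
qed

text \<open>Subtracting the mean \<open>d / n\<close> from the diagonal makes the matrix traceless
  and leaves its pairing with traceless matrices unchanged; the mean is \<open>d / n\<close> since
  every exponent has degree \<open>d\<close> and the weights \<open>lam\<close> sum to
  \<open>1\<close>.\<close>

lemma moment_map_free_form:
  assumes n: "n > 0"
  shows "moment_map n ip v = diagm n (\<lambda>i. of_real (real d / real n -
     (\<Sum>a\<in>S. lam a * real (Poly_Mapping.lookup a i))))"
proof (rule moment_map_eqI)
  let ?w = "\<lambda>i. \<Sum>a\<in>S. lam a * real (Poly_Mapping.lookup a i)"
  let ?H = "diagm n (\<lambda>i. of_real (real d / real n - ?w i))"
  have "(\<Sum>i<n. ?w i) = (\<Sum>a\<in>S. lam a * (\<Sum>i<n. real (Poly_Mapping.lookup a i)))"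
    by (subst sum.swap) (simp add: sum_distrib_left)
  also have "\<dots> = (\<Sum>a\<in>S. lam a * real d)"
    using S by (intro sum.cong refl) (auto simp: exponents_def simp flip: of_nat_sum)
  also have "\<dots> = real d" using lam1 by (simp flip: sum_distrib_right)
  finally have sum_w: "(\<Sum>i<n. ?w i) = real d" .
  have "mat_trace ?H = of_real (\<Sum>i<n. real d / real n - ?w i)"
    by (simp add: mat_trace_def diagm_def)
  also have "(\<Sum>i<n. real d / real n - ?w i) = 0"
    unfolding sum_subtractf sum_w using n by simp
  finally show "?H \<in> traceless_hermitian n"
    by (simp add: traceless_hermitian_def mat_adjoint_diagm)
  fix A assume "A \<in> traceless_hermitian n"
  then have A: "A \<in> carrier_mat n n" and trA: "(\<Sum>i<n. A $$ (i, i)) = 0"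
    by (auto simp: traceless_hermitian_def mat_trace_def)
  have "mat_trace (?H * A) = (\<Sum>i<n. of_real (real d / real n - ?w i) * A $$ (i, i))"
    using A by (auto simp: mat_trace_def diagm_def scalar_prod_def if_distrib[of "\<lambda>x. x * _"] cong: if_cong
        intro!: sum.cong)
  also have "\<dots> = of_real (real d / real n) * (\<Sum>i<n. A $$ (i, i)) - (\<Sum>i<n. of_real (?w i) * A $$ (i, i))"
    by (simp add: left_diff_distrib sum_subtractf sum_distrib_left)
  also have "\<dots> = ip v (lie_rep A v) / ip v v"
    unfolding trA ip_lie_rep_free_form[OF A] ip_free_form_self by simp
  finally show "mat_trace (?H * A) = ip v (lie_rep A v) / ip v v" .
qed

end

lemma gap_le_free_weights:
  assumes inv: "SU_invariant_inner n d ip" and n: "n > 0"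
    and fin: "finite S" and S: "S \<subseteq> exponents n d" and free: "free_weights n S"
    and y0: "(\<Sum>i<n. y i) = (0::real)"
    and y1: "\<And>a. a \<in> S \<Longrightarrow> (\<Sum>i<n. y i * real (Poly_Mapping.lookup a i)) = 1"
    and lam0: "\<And>a. a \<in> S \<Longrightarrow> lam a \<ge> 0" and lam1: "(\<Sum>a\<in>S. lam a) = 1"
  shows "gap n d ip \<le> sqrt (\<Sum>i<n. ((\<Sum>a\<in>S. lam a * real (Poly_Mapping.lookup a i)) - real d / real n)\<^sup>2)"
proof -
  \<comment> \<open>Dividing by the squared norm of the monomial lets any prescribed convex weights
    occur as the squared norms of the components of \<open>v\<close>, whatever the invariant inner
    product is.\<close>
  define c where "c = (\<lambda>a. sqrt (lam a / Re (ip (xpow a) (xpow a))))"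
  define v where "v = (\<Sum>a\<in>S. Poly_Mapping.single a (complex_of_real (c a)))"
  have pos: "Re (ip (xpow a) (xpow a)) > 0" if "a \<in> S" for a
    using ip_monomial_self(2)[OF inv] S that by auto
  have lam: "lam a = (c a)\<^sup>2 * Re (ip (xpow a) (xpow a))" if "a \<in> S" for a
    using pos[OF that] lam0[OF that] by (simp add: c_def)
  have vf: "v \<in> forms n d" by (rule free_form[OF inv fin S free v_def lam lam1])
  have v0: "v \<noteq> 0"
    using ip_free_form_self[OF inv fin S free v_def lam lam1] ip_zero[OF inv vf] by auto
  have keys: "Poly_Mapping.keys v \<subseteq> S" unfolding v_def by (rule keys_sum_single[OF fin])
  have uns: "unstable n v"
    using keys S by (intro unstable_if_weight_functional[OF _ y0] y1) (auto simp: exponents_def)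
  have "gap n d ip \<le> frobenius_norm (moment_map n ip v)"
    unfolding gap_def using vf v0 uns
    by (intro cInf_lower bdd_belowI[of _ 0]) (auto simp: frobenius_norm_def intro!: sum_nonneg)
  also have "moment_map n ip v = diagm n (\<lambda>i. of_real (real d / real n -
     (\<Sum>a\<in>S. lam a * real (Poly_Mapping.lookup a i))))"
    by (rule moment_map_free_form[OF inv fin S free v_def lam lam1 n])
  also have "frobenius_norm \<dots> = sqrt (\<Sum>i<n. ((\<Sum>a\<in>S. lam a * real (Poly_Mapping.lookup a i)) - real d / real n)\<^sup>2)"
  proof -
    have "(\<Sum>j<n. (cmod (if i = j then of_real (x i) else 0))\<^sup>2) = (x i)\<^sup>2" if "i < n" for i and x :: "nat \<Rightarrow> real"
      using that by (simp add: if_distrib[of "\<lambda>z. (cmod z)\<^sup>2"] cong: if_cong)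
    then show ?thesis
      unfolding frobenius_norm_def diagm_def
      by (simp add: power2_commute flip: of_real_diff cong: if_cong)
  qed
  finally show ?thesis .
qed

subsection \<open>Multilinear weights\<close>

text \<open>The variable \<open>x\<^sub>b\<^sub>,\<^sub>k\<close> with \<open>b < d\<close>, \<open>1 \<le> k \<le> m\<close> has number \<open>b * m + k - 1\<close>.\<close>

definition tuple_exponent :: "nat \<Rightarrow> nat list \<Rightarrow> nat \<Rightarrow>\<^sub>0 nat" where
  "tuple_exponent m xs = (\<Sum>b<length xs. Poly_Mapping.single (b * m + xs ! b - 1) 1)"

lemma block_index_eq_iff:
  assumes "k < m" "l < (m::nat)"
  shows "b * m + k = c * m + l \<longleftrightarrow> b = c \<and> k = l"
proof
  assume eq: "b * m + k = c * m + l"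
  then have "(b * m + k) div m = (c * m + l) div m" "(b * m + k) mod m = (c * m + l) mod m" by simp_all
  then show "b = c \<and> k = l" using assms by simp
qed simp

lemma lookup_tuple_exponent:
  assumes xs: "set xs \<subseteq> {1..m}" and k: "k < m"
  shows "Poly_Mapping.lookup (tuple_exponent m xs) (b * m + k) = of_bool (b < length xs \<and> xs ! b = Suc k)"
proof -
  have "Poly_Mapping.lookup (tuple_exponent m xs) (b * m + k)
      = (\<Sum>c<length xs. if c = b \<and> xs ! b = Suc k then 1 else 0)"
    unfolding tuple_exponent_def lookup_sum
  proof (rule sum.cong[OF refl])
    fix c assume "c \<in> {..<length xs}"
    then have "xs ! c \<in> {1..m}" using xs nth_mem by blast
    then have "xs ! c - 1 < m" "xs ! c \<ge> 1" by auto
    then show "Poly_Mapping.lookup (Poly_Mapping.single (c * m + xs ! c - 1) 1) (b * m + k)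
        = (if c = b \<and> xs ! b = Suc k then 1 else 0)"
      using block_index_eq_iff[of "xs ! c - 1" m k c b] k
      by (auto simp: lookup_single when_def)
  qed
  also have "\<dots> = of_bool (b < length xs \<and> xs ! b = Suc k)"
    by (cases "xs ! b = Suc k") auto
  finally show ?thesis .
qed

lemma sum_blocks:
  fixes F :: "nat \<Rightarrow> 'a::comm_monoid_add"
  shows "(\<Sum>i<d * m. F i) = (\<Sum>b<d. \<Sum>k<m. F (b * m + k))"
proof -
  have "(\<Sum>i<d * m. F i) = (\<Sum>b<d. sum F {b * m..<b * m + m})"
    by (rule sum.nat_group[symmetric])
  also have "\<dots> = (\<Sum>b<d. \<Sum>k<m. F (b * m + k))"
  proof (rule sum.cong[OF refl])
    fix b
    show "sum F {b * m..<b * m + m} = (\<Sum>k<m. F (b * m + k))"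
      by (rule sum.reindex_bij_witness[of _ "\<lambda>k. b * m + k" "\<lambda>i. i - b * m"]) auto
  qed
  finally show ?thesis .
qed

lemma sum_Suc_lessThan: "(\<Sum>k<m. F (Suc k)) = (\<Sum>k=1..m. F k)"
  by (rule sum.reindex_bij_witness[of _ "\<lambda>k. k - 1" Suc]) auto

lemma tuple_exponent_in_exponents:
  assumes xs: "set xs \<subseteq> {1..m}" "length xs = d"
  shows "tuple_exponent m xs \<in> exponents (d * m) d"
proof -
  have "Poly_Mapping.keys (tuple_exponent m xs) \<subseteq> (\<Union>b<length xs. {b * m + xs ! b - 1})"
    unfolding tuple_exponent_def using keys_sum[of "\<lambda>b. Poly_Mapping.single (b * m + xs ! b - 1) (1::nat)" "{..<length xs}"]
    by auto
  also have "\<dots> \<subseteq> {..<d * m}"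
  proof -
    have "b * m + xs ! b - 1 < d * m" if b: "b < length xs" for b
    proof -
      have "xs ! b \<in> {1..m}" using xs b nth_mem by blast
      then have "b * m + xs ! b - 1 < Suc b * m" by auto
      also have "\<dots> \<le> d * m" using b xs by (intro mult_le_mono1) auto
      finally show ?thesis .
    qed
    then show ?thesis by auto
  qed
  finally have "Poly_Mapping.keys (tuple_exponent m xs) \<subseteq> {..<d * m}" .
  moreover have "(\<Sum>i<d * m. Poly_Mapping.lookup (tuple_exponent m xs) i) = d"
  proof -
    have "(\<Sum>i<d * m. Poly_Mapping.lookup (tuple_exponent m xs) i)
        = (\<Sum>b<d. \<Sum>k<m. if Suc k = xs ! b then 1 else 0)"
      unfolding sum_blocks using xs by (intro sum.cong refl) (auto simp: lookup_tuple_exponent)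
    also have "\<dots> = (\<Sum>b<d. \<Sum>k=1..m. if k = xs ! b then 1 else 0)"
      by (rule sum.cong[OF refl], rule sum_Suc_lessThan)
    also have "\<dots> = (\<Sum>b<d. 1)"
    proof (rule sum.cong[OF refl])
      fix b assume "b \<in> {..<d}"
      then have "xs ! b \<in> {1..m}" using xs nth_mem by blast
      then show "(\<Sum>k=1..m. if k = xs ! b then 1 else 0) = (1::nat)" by simp
    qed
    finally show ?thesis by simp
  qed
  ultimately show ?thesis by (simp add: exponents_def)
qed

text \<open>At the variable of block \<open>e\<close> chosen by \<open>xs\<close>, the left side is
  positive while \<open>tuple_exponent m ys\<close> vanishes, so the added variable \<open>j\<close>
  must be that one. Two such blocks would place \<open>j\<close> in both.\<close>

lemma tuple_exponent_free:
  assumes xs: "set xs \<subseteq> {1..m}" "length xs = d" and ys: "set ys \<subseteq> {1..m}" "length ys = d"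
    and bc: "b < d" "c < d" "b \<noteq> c" "xs ! b \<noteq> ys ! b" "xs ! c \<noteq> ys ! c"
  shows "tuple_exponent m xs + Poly_Mapping.single i 1 \<noteq> tuple_exponent m ys + Poly_Mapping.single j 1"
proof
  assume eq: "tuple_exponent m xs + Poly_Mapping.single i 1 = tuple_exponent m ys + Poly_Mapping.single j 1"
  have "j = e * m + (xs ! e - 1)" if e: "e < d" "xs ! e \<noteq> ys ! e" for e
  proof -
    have xe: "xs ! e \<in> {1..m}" using xs e nth_mem by blast
    then have k: "xs ! e - 1 < m" "Suc (xs ! e - 1) = xs ! e" by auto
    have "Poly_Mapping.lookup (tuple_exponent m xs + Poly_Mapping.single i 1) (e * m + (xs ! e - 1)) \<ge> 1"
      using lookup_tuple_exponent[OF xs(1) k(1), of e] k(2) e xs by (simp add: lookup_add)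
    moreover have "Poly_Mapping.lookup (tuple_exponent m ys) (e * m + (xs ! e - 1)) = 0"
      using lookup_tuple_exponent[OF ys(1) k(1), of e] k(2) e ys by simp
    ultimately show ?thesis
      unfolding eq by (simp add: lookup_add lookup_single when_def split: if_splits)
  qed
  from this[of b] this[of c] have "b * m + (xs ! b - 1) = c * m + (xs ! c - 1)" using bc by simp
  moreover have "xs ! b \<in> {1..m}" "xs ! c \<in> {1..m}" using xs bc nth_mem by blast+
  then have "xs ! b - 1 < m" "xs ! c - 1 < m" by auto
  ultimately show False using block_index_eq_iff[of "xs ! b - 1" m "xs ! c - 1" b c] bc by auto
qed

section \<open>Coordinates of the weights and points of their convex hull\<close>

lemma lookup_eps:
  "Poly_Mapping.lookup (eps m b i) (c, k) = (if c = b then of_bool (k = i) - of_bool (k \<in> {1..m}) / real m else 0)"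
proof -
  have "Poly_Mapping.lookup (\<Sum>k=1..m. Poly_Mapping.single (b, k) (1 / real m)) (c, k)
      = (\<Sum>l=1..m. if l = k then of_bool (c = b) / real m else 0)"
    unfolding lookup_sum by (intro sum.cong) (auto simp: lookup_single when_def)
  also have "\<dots> = of_bool (c = b \<and> k \<in> {1..m}) / real m" by simp
  finally show ?thesis by (auto simp: eps_def lookup_minus lookup_single when_def)
qed

lemma lookup_eps_tuple:
  assumes xs: "set xs \<subseteq> {1..m}"
  shows "Poly_Mapping.lookup (eps_tuple m xs) (b, k)
     = (if b < length xs \<and> k \<in> {1..m} then of_bool (xs ! b = k) - 1 / real m else 0)"
proof -
  have "Poly_Mapping.lookup (eps_tuple m xs) (b, k)
      = (\<Sum>c<length xs. if c = b then of_bool (k = xs ! b) - of_bool (k \<in> {1..m}) / real m else 0)"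
    unfolding eps_tuple_def lookup_sum by (intro sum.cong) (auto simp: lookup_eps)
  also have "\<dots> = (if b < length xs then of_bool (k = xs ! b) - of_bool (k \<in> {1..m}) / real m else 0)"
    by simp
  also have "\<dots> = (if b < length xs \<and> k \<in> {1..m} then of_bool (xs ! b = k) - 1 / real m else 0)"
  proof (cases "b < length xs")
    case True
    then have "xs ! b \<in> {1..m}" using xs nth_mem by blast
    then show ?thesis by auto
  qed simp
  finally show ?thesis .
qed

lemma lookup_scaleR_real: "Poly_Mapping.lookup (c *\<^sub>R (x :: 'a \<Rightarrow>\<^sub>0 real)) k = c * Poly_Mapping.lookup x k"
  by (simp add: scaleR_poly_mapping_def Poly_Mapping.map.rep_eq when_def)

text \<open>The coefficients are attached to the indices and not to the points, as the weights
  \<open>lam w\<close> on triples are later. The set on the right is convex and contains all points,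
  hence contains the hull.\<close>

lemma convex_hull_image_finite_subset:
  fixes f :: "'i \<Rightarrow> 'a::real_vector"
  assumes "finite I"
  shows "convex hull (f ` I) \<subseteq> {\<Sum>i\<in>I. u i *\<^sub>R f i | u. (\<forall>i\<in>I. 0 \<le> u i) \<and> sum u I = 1}" (is "_ \<subseteq> ?C")
proof (rule hull_minimal)
  show "f ` I \<subseteq> ?C"
  proof
    fix x assume "x \<in> f ` I"
    then obtain j where j: "j \<in> I" "x = f j" by blast
    have "(\<Sum>i\<in>I. (if i = j then 1 else 0) *\<^sub>R f i) = (\<Sum>i\<in>I. if i = j then f j else 0)"
      by (intro sum.cong) auto
    then show "x \<in> ?C" using j assms
      by (intro CollectI exI[of _ "\<lambda>i. if i = j then 1 else (0::real)"]) simp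
  qed
  show "convex ?C"
  proof (rule convexI)
    fix x y s t assume "x \<in> ?C" "y \<in> ?C" and st: "0 \<le> s" "0 \<le> (t::real)" "s + t = 1"
    then obtain u v where u: "x = (\<Sum>i\<in>I. u i *\<^sub>R f i)" "\<forall>i\<in>I. 0 \<le> u i" "sum u I = 1"
      and v: "y = (\<Sum>i\<in>I. v i *\<^sub>R f i)" "\<forall>i\<in>I. 0 \<le> v i" "sum v I = 1"
      by blast
    have "s *\<^sub>R x + t *\<^sub>R y = (\<Sum>i\<in>I. (s * u i + t * v i) *\<^sub>R f i)"
      by (simp add: u v scaleR_sum_right sum.distrib scaleR_add_left)
    moreover have "(\<Sum>i\<in>I. s * u i + t * v i) = 1"
      using u v st by (simp add: sum.distrib flip: sum_distrib_left)
    ultimately show "s *\<^sub>R x + t *\<^sub>R y \<in> ?C"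
      using u v st by (intro CollectI exI[of _ "\<lambda>i. s * u i + t * v i"]) auto
  qed
qed

context
  fixes d m :: nat and I :: "'i set" and t :: "'i \<Rightarrow> nat list"
  assumes m: "m > 0" and fin: "finite I"
    and len: "\<And>w. w \<in> I \<Longrightarrow> length (t w) = d" and range: "\<And>w. w \<in> I \<Longrightarrow> set (t w) \<subseteq> {1..m}"
begin

text \<open>Coordinate \<open>(b, k)\<close> is the total weight of the tuples with entry
  \<open>k\<close> in block \<open>b\<close>, minus \<open>1 / m\<close>. The norm thus measures how
  far the block marginals are from uniform, and it is the same expression as the Frobenius norm of
  the moment map.\<close>

lemma L2_set_eps_combination:
  assumes lam1: "sum lam I = 1" and x: "x = (\<Sum>w\<in>I. lam w *\<^sub>R eps_tuple m (t w))"
  shows "L2_set (Poly_Mapping.lookup x) (Poly_Mapping.keys x)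
    = sqrt (\<Sum>b<d. \<Sum>k=1..m. ((\<Sum>w\<in>I. lam w * of_bool (t w ! b = k)) - 1 / real m)\<^sup>2)"
proof -
  have look: "Poly_Mapping.lookup x (b, k) = (if b < d \<and> k \<in> {1..m}
      then (\<Sum>w\<in>I. lam w * of_bool (t w ! b = k)) - 1 / real m else 0)" for b k
  proof -
    have "Poly_Mapping.lookup x (b, k) = (\<Sum>w\<in>I. lam w * (if b < d \<and> k \<in> {1..m} then of_bool (t w ! b = k) - 1 / real m else 0))"
      unfolding x lookup_sum lookup_scaleR_real using len range by (intro sum.cong refl) (simp add: lookup_eps_tuple)
    also have "\<dots> = (if b < d \<and> k \<in> {1..m} then (\<Sum>w\<in>I. lam w * of_bool (t w ! b = k)) - sum lam I * (1 / real m) else 0)"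
      by (cases "b < d \<and> k \<in> {1..m}") (simp_all only: sum_distrib_right right_diff_distrib sum_subtractf simp_thms if_True if_False mult_zero_right sum.neutral_const)
    finally show ?thesis by (simp add: lam1)
  qed
  have "(\<Sum>z\<in>Poly_Mapping.keys x. (Poly_Mapping.lookup x z)\<^sup>2) = (\<Sum>z\<in>{..<d} \<times> {1..m}. (Poly_Mapping.lookup x z)\<^sup>2)"
    using look by (intro sum.mono_neutral_left) (auto simp: in_keys_iff split: if_splits)
  also have "\<dots> = (\<Sum>b<d. \<Sum>k=1..m. ((\<Sum>w\<in>I. lam w * of_bool (t w ! b = k)) - 1 / real m)\<^sup>2)"
    unfolding sum.cartesian_product' by (intro sum.cong refl) (auto simp: look)
  finally show ?thesis by (simp add: L2_set_def)
qed

lemma euclid_dist_0_hull_le: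
  assumes lam0: "\<And>w. w \<in> I \<Longrightarrow> lam w \<ge> 0" and lam1: "sum lam I = 1"
  shows "euclid_dist_0 (convex hull ((\<lambda>w. eps_tuple m (t w)) ` I))
     \<le> sqrt (\<Sum>b<d. \<Sum>k=1..m. ((\<Sum>w\<in>I. lam w * of_bool (t w ! b = k)) - 1 / real m)\<^sup>2)"
proof -
  define x where "x = (\<Sum>w\<in>I. lam w *\<^sub>R eps_tuple m (t w))"
  have "x \<in> convex hull ((\<lambda>w. eps_tuple m (t w)) ` I)"
    unfolding x_def by (intro convex_sum fin convex_convex_hull lam1 lam0 hull_inc) auto
  then have "euclid_dist_0 (convex hull ((\<lambda>w. eps_tuple m (t w)) ` I))
      \<le> L2_set (Poly_Mapping.lookup x) (Poly_Mapping.keys x)"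
    unfolding euclid_dist_0_def by (intro cINF_lower bdd_belowI[of _ 0]) auto
  then show ?thesis by (simp add: L2_set_eps_combination[OF lam1 x_def])
qed

text \<open>Any point of the hull is a combination with weights \<open>lam\<close>; the form with
  these weights on the corresponding multilinear monomials is unstable and its moment map has the
  norm of the point. Passing to the infimum over all points gives the bound.\<close>

lemma gap_le_euclid_dist_0_hull:
  assumes inv: "SU_invariant_inner (d * m) d ip" and d: "d > 0" and ne: "I \<noteq> {}"
    and far: "\<And>w w'. w \<in> I \<Longrightarrow> w' \<in> I \<Longrightarrow> w \<noteq> w' \<Longrightarrow>
       \<exists>b c. b < d \<and> c < d \<and> b \<noteq> c \<and> t w ! b \<noteq> t w' ! b \<and> t w ! c \<noteq> t w' ! c"
    and y0: "(\<Sum>b<d. \<Sum>k=1..m. y b k) = (0::real)"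
    and y1: "\<And>w. w \<in> I \<Longrightarrow> (\<Sum>b<d. y b (t w ! b)) = 1"
  shows "gap (d * m) d ip \<le> euclid_dist_0 (convex hull ((\<lambda>w. eps_tuple m (t w)) ` I))"
  unfolding euclid_dist_0_def
proof (rule cINF_greatest)
  show "convex hull ((\<lambda>w. eps_tuple m (t w)) ` I) \<noteq> {}" using ne by simp
  fix x assume "x \<in> convex hull ((\<lambda>w. eps_tuple m (t w)) ` I)"
  then obtain lam where x: "x = (\<Sum>w\<in>I. lam w *\<^sub>R eps_tuple m (t w))"
    and lam0: "\<And>w. w \<in> I \<Longrightarrow> lam w \<ge> 0" and lam1: "sum lam I = 1"
    using convex_hull_image_finite_subset[OF fin, of "\<lambda>w. eps_tuple m (t w)"] by blast
  let ?a = "\<lambda>w. tuple_exponent m (t w)"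
  have root: "w = w'" if "w \<in> I" "w' \<in> I" "?a w + Poly_Mapping.single i 1 = ?a w' + Poly_Mapping.single j 1" for w w' i j
    using far[OF that(1,2)] that(3) tuple_exponent_free[OF range[OF that(1)] len[OF that(1)] range[OF that(2)] len[OF that(2)]]
    by blast
  \<comment> \<open>Equal exponents are the instance \<open>i = j\<close> of a root relation, so
    injectivity comes out of the same separation in two blocks.\<close>
  have inj: "inj_on ?a I" by (rule inj_onI) (rule root[where i = 0 and j = 0], auto)
  let ?lam = "\<lambda>a. lam (inv_into I ?a a)"
  have lam': "?lam (?a w) = lam w" if "w \<in> I" for w
    using inv_into_f_f[OF inj that] by simp
  have "gap (d * m) d ip \<le> sqrt (\<Sum>i<d * m. ((\<Sum>a\<in>?a ` I. ?lam a * real (Poly_Mapping.lookup a i)) - real d / real (d * m))\<^sup>2)"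
  \<comment> \<open>A variable number is split into its block and its offset; the successor converts
    offsets from \<open>0\<close> to values from \<open>1\<close>.\<close>
  proof (rule gap_le_free_weights[OF inv, where y = "\<lambda>i. y (i div m) (Suc (i mod m))"])
    show "d * m > 0" using d m by simp
    show "?a ` I \<subseteq> exponents (d * m) d" using tuple_exponent_in_exponents range len by auto
    show "free_weights (d * m) (?a ` I)" unfolding free_weights_def using root by blast
    show "(\<Sum>i<d * m. y (i div m) (Suc (i mod m))) = 0"
    proof -
      have "(\<Sum>i<d * m. y (i div m) (Suc (i mod m))) = (\<Sum>b<d. \<Sum>k<m. y b (Suc k))"
        unfolding sum_blocks by (intro sum.cong refl) auto
      then show ?thesis using y0 by (simp only: sum_Suc_lessThan)
    qed
    show "?lam a \<ge> 0" if "a \<in> ?a ` I" for a using that lam0 lam' by auto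
    show "(\<Sum>a\<in>?a ` I. ?lam a) = 1"
      using lam1 by (simp add: sum.reindex[OF inj] lam' cong: sum.cong)
    fix a assume "a \<in> ?a ` I"
    then obtain w where w: "w \<in> I" "a = ?a w" by blast
    have "(\<Sum>i<d * m. y (i div m) (Suc (i mod m)) * real (Poly_Mapping.lookup a i))
        = (\<Sum>b<d. \<Sum>k<m. if Suc k = t w ! b then y b (t w ! b) else 0)"
      unfolding sum_blocks w(2) using w(1) range len
      by (intro sum.cong refl) (auto simp: lookup_tuple_exponent)
    also have "\<dots> = (\<Sum>b<d. \<Sum>k=1..m. if k = t w ! b then y b (t w ! b) else 0)"
      by (rule sum.cong[OF refl], rule sum_Suc_lessThan)
    also have "\<dots> = (\<Sum>b<d. y b (t w ! b))"
    proof (rule sum.cong[OF refl])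
      fix b assume "b \<in> {..<d}"
      then have "t w ! b \<in> {1..m}" using range[OF w(1)] len[OF w(1)] nth_mem by blast
      then show "(\<Sum>k=1..m. if k = t w ! b then y b (t w ! b) else 0) = y b (t w ! b)" by simp
    qed
    finally show "(\<Sum>i<d * m. y (i div m) (Suc (i mod m)) * real (Poly_Mapping.lookup a i)) = 1"
      using y1[OF w(1)] by simp
  qed (use fin in auto)
  also have "(\<Sum>i<d * m. ((\<Sum>a\<in>?a ` I. ?lam a * real (Poly_Mapping.lookup a i)) - real d / real (d * m))\<^sup>2)
     = (\<Sum>b<d. \<Sum>k<m. ((\<Sum>w\<in>I. lam w * of_bool (t w ! b = Suc k)) - 1 / real m)\<^sup>2)"
    unfolding sum_blocks
  proof (intro sum.cong refl)
    fix b k assume bk: "b \<in> {..<d}" "k \<in> {..<m}"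
    have "(\<Sum>a\<in>?a ` I. ?lam a * real (Poly_Mapping.lookup a (b * m + k)))
        = (\<Sum>w\<in>I. lam w * of_bool (t w ! b = Suc k))"
      unfolding sum.reindex[OF inj] o_def
    proof (rule sum.cong[OF refl])
      fix w assume w: "w \<in> I"
      show "?lam (?a w) * real (Poly_Mapping.lookup (?a w) (b * m + k)) = lam w * of_bool (t w ! b = Suc k)"
        unfolding lam'[OF w] using lookup_tuple_exponent[OF range[OF w], of k b] bk len[OF w] by simp
    qed
    then show "((\<Sum>a\<in>?a ` I. ?lam a * real (Poly_Mapping.lookup a (b * m + k))) - real d / real (d * m))\<^sup>2
       = ((\<Sum>w\<in>I. lam w * of_bool (t w ! b = Suc k)) - 1 / real m)\<^sup>2"
      using d by simp
  qed
  also have "\<dots> = (\<Sum>b<d. \<Sum>k=1..m. ((\<Sum>w\<in>I. lam w * of_bool (t w ! b = k)) - 1 / real m)\<^sup>2)"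
    by (rule sum.cong[OF refl], rule sum_Suc_lessThan)
  also have "sqrt \<dots> = L2_set (Poly_Mapping.lookup x) (Poly_Mapping.keys x)"
    by (rule L2_set_eps_combination[OF lam1 x, symmetric])
  finally show "gap (d * m) d ip \<le> L2_set (Poly_Mapping.lookup x) (Poly_Mapping.keys x)" .
qed

end

subsection \<open>The index maps\<close>

text \<open>With \<open>u = j + i - 2\<close>, the ceiling of \<open>(u + 1) / r\<close> is
  \<open>u div r + 1\<close>, and reduction of a successor to the residues \<open>1, ..., m\<close>
  is ordinary reduction followed by adding \<open>1\<close>.\<close>

lemma sigma_low_eq:
  assumes "i \<ge> 1" "j \<ge> 1" "r \<ge> 1" "m \<ge> 1"
  shows "sigma_low r m i j = ((j + i - 2) div r) mod m + 1"
proof -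
  define u where "u = j + i - 2"
  have ju: "real j + real i - 1 = real u + 1" using assms by (simp add: u_def)
  have "\<lceil>(real u + 1) / real r\<rceil> = int (u div r) + 1"
  proof (rule ceiling_unique)
    have "real u = real (r * (u div r) + u mod r)" by simp
    then have u: "real u = real r * real (u div r) + real (u mod r)"
      by (simp only: of_nat_add of_nat_mult)
    have lt: "real (u mod r) + 1 \<le> real r"
      using assms mod_less_divisor[of r u] by linarith
    show "(real u + 1) / real r \<le> real_of_int (int (u div r) + 1)"
      using assms lt unfolding u by (simp add: field_simps)
    show "real_of_int (int (u div r) + 1) - 1 < (real u + 1) / real r"
      using assms unfolding u by (simp add: field_simps)
  qed
  then have "sigma_low r m i j = mod' (Suc (u div r)) m"
    unfolding sigma_low_def ju by (simp add: nat_add_distrib)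
  also have "\<dots> = (u div r) mod m + 1" using assms by (simp add: mod'_def mod_Suc)
  finally show ?thesis by (simp add: u_def)
qed

text \<open>For \<open>l = r + i\<close> the first swapped index is \<open>2 r + 1 - l\<close>.\<close>

lemma sigma_eq:
  assumes "1 \<le> l" "l < 2 * r" "m \<ge> 1" "j \<ge> 1"
  shows "sigma r m l j = (if l \<le> r then ((j + l - 2) div r) mod m + 1
     else ((Transposition.transpose (2 * r + 1 - l) (r + 1) j - 1) div r) mod m + 1)"
proof (cases "l \<le> r")
  case True
  then show ?thesis using assms by (simp add: sigma_def sigma_low_eq)
next
  case False
  then have "r - (l - r) + 1 = 2 * r + 1 - l" using assms by simp
  moreover have "Transposition.transpose (2 * r + 1 - l) (r + 1) j \<ge> 1"
    using assms by (auto simp: Transposition.transpose_def)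
  ultimately show ?thesis using False assms by (simp add: sigma_def sigma_low_eq)
qed

lemma sigma_range:
  assumes "1 \<le> l" "l < 2 * r" "m \<ge> 1" "j \<ge> 1"
  shows "sigma r m l j \<in> {1..m}"
  using assms mod_less_divisor[of m] by (auto simp: sigma_eq Suc_le_eq)

lemma sum_periodic_shift:
  fixes g :: "nat \<Rightarrow> real"
  assumes "\<And>u. g (u + N) = g u"
  shows "(\<Sum>u<N. g (u + c)) = (\<Sum>u<N. g u)"
proof (induction c)
  case (Suc c)
  have "g c + (\<Sum>u<N. g (u + Suc c)) = (\<Sum>u<Suc N. g (u + c))"
    by (subst sum.lessThan_Suc_shift) simp
  also have "\<dots> = (\<Sum>u<N. g (u + c)) + g c" using assms[of c] by (simp add: add.commute)
  finally show ?case using Suc by simp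
qed simp

text \<open>Every value is taken exactly \<open>r\<close> times: \<open>sigma\<close> is constant on
  runs of \<open>r\<close> consecutive indices, and neither a cyclic shift nor a transposition of
  \<open>[r m]\<close> changes the sizes of the fibres.\<close>

lemma sum_sigma:
  fixes f :: "nat \<Rightarrow> real"
  assumes l: "1 \<le> l" "l < 2 * r" and m: "m \<ge> 2"
  shows "(\<Sum>j=1..r * m. f (sigma r m l j)) = real r * (\<Sum>k=1..m. f k)"
proof -
  define g where "g u = f ((u div r) mod m + 1)" for u
  have r: "r \<ge> 1" using l by simp
  have per: "g (u + r * m) = g u" for u
    using r by (simp add: g_def)
  have base: "(\<Sum>u<r * m. g u) = real r * (\<Sum>k=1..m. f k)"
  proof -
    have "(\<Sum>u<r * m. g u) = (\<Sum>k<m. \<Sum>b<r. g (k * r + b))"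
      using sum_blocks[of g m r] by (simp add: mult.commute)
    also have "\<dots> = (\<Sum>k<m. real r * f (Suc k))"
      by (intro sum.cong refl) (simp add: g_def)
    also have "\<dots> = real r * (\<Sum>k=1..m. f k)"
      by (subst sum_Suc_lessThan) (simp add: sum_distrib_left)
    finally show ?thesis .
  qed
  have low: "(\<Sum>j=1..r * m. g (j + c - 1)) = real r * (\<Sum>k=1..m. f k)" for c
  proof -
    have "(\<Sum>j=1..r * m. g (j + c - 1)) = (\<Sum>u<r * m. g (u + c))"
      by (subst sum_Suc_lessThan[symmetric]) simp
    then show ?thesis using sum_periodic_shift[of g, OF per] base by simp
  qed
  show ?thesis
  proof (cases "l \<le> r")
    case True
    then have "(\<Sum>j=1..r * m. f (sigma r m l j)) = (\<Sum>j=1..r * m. g (j + (l - 1) - 1))"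
      using l m by (intro sum.cong refl) (auto simp: sigma_eq g_def numeral_2_eq_2)
    then show ?thesis using low by simp
  next
    case False
    let ?\<tau> = "Transposition.transpose (2 * r + 1 - l) (r + 1)"
    \<comment> \<open>The transposition must stay inside \<open>[r m]\<close>; this is where
      \<open>m \<ge> 2\<close> enters.\<close>
    have "r + 1 \<le> r * m" using r m mult_le_mono2[of 2 m r] by linarith
    then have \<tau>: "?\<tau> j \<in> {1..r * m}" if "j \<in> {1..r * m}" for j
      using that l False by (auto simp: Transposition.transpose_def)
    have "(\<Sum>j=1..r * m. f (sigma r m l j)) = (\<Sum>j=1..r * m. g (?\<tau> j - 1))"
      using False l m by (intro sum.cong refl) (auto simp: sigma_eq g_def)
    also have "\<dots> = (\<Sum>j=1..r * m. g (j - 1))"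
      by (rule sum.reindex_bij_witness[of _ ?\<tau> ?\<tau>]) (use \<tau> in auto)
    finally show ?thesis using low[of 0] by simp
  qed
qed

text \<open>Sums of pullbacks of functions on \<open>[m]\<close>, compared on \<open>[r m]\<close>
  only. Each map contributes the constants, so the \<open>r\<close> shifts alone reach dimension at
  most \<open>r (m - 1) + 1\<close>, which falls short of \<open>r m\<close> by
  \<open>r - 1\<close>; the \<open>r - 1\<close> transposed maps make up for the deficit.\<close>

definition sigma_span :: "nat \<Rightarrow> nat \<Rightarrow> (nat \<Rightarrow> real) set" where
  "sigma_span r m = {U. \<exists>y. \<forall>j\<in>{1..r * m}. U j = (\<Sum>l\<in>{1..<2 * r}. y l (sigma r m l j))}"

lemma sigma_span_cong:
  assumes "U \<in> sigma_span r m" "\<And>j. j \<in> {1..r * m} \<Longrightarrow> V j = U j"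
  shows "V \<in> sigma_span r m"
  using assms by (auto simp: sigma_span_def)

lemma sigma_span_add:
  assumes "U \<in> sigma_span r m" "V \<in> sigma_span r m"
  shows "(\<lambda>j. U j + V j) \<in> sigma_span r m"
proof -
  obtain y z where "\<forall>j\<in>{1..r * m}. U j = (\<Sum>l\<in>{1..<2 * r}. y l (sigma r m l j))"
    "\<forall>j\<in>{1..r * m}. V j = (\<Sum>l\<in>{1..<2 * r}. z l (sigma r m l j))"
    using assms unfolding sigma_span_def by blast
  then show ?thesis unfolding sigma_span_def
    by (intro CollectI exI[of _ "\<lambda>l k. y l k + z l k"]) (simp add: sum.distrib)
qed

lemma sigma_span_scale:
  assumes "U \<in> sigma_span r m"
  shows "(\<lambda>j. c * U j) \<in> sigma_span r m"
proof -
  obtain y where "\<forall>j\<in>{1..r * m}. U j = (\<Sum>l\<in>{1..<2 * r}. y l (sigma r m l j))"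
    using assms unfolding sigma_span_def by blast
  then show ?thesis unfolding sigma_span_def
    by (intro CollectI exI[of _ "\<lambda>l k. c * y l k"]) (simp add: sum_distrib_left)
qed

lemma sigma_span_diff:
  assumes "U \<in> sigma_span r m" "V \<in> sigma_span r m"
  shows "(\<lambda>j. U j - V j) \<in> sigma_span r m"
  using sigma_span_add[OF assms(1) sigma_span_scale[OF assms(2), of "-1"]] by simp

lemma sigma_span_sum:
  assumes "\<And>x. x \<in> X \<Longrightarrow> F x \<in> sigma_span r m"
  shows "(\<lambda>j. \<Sum>x\<in>X. F x j) \<in> sigma_span r m"
  using assms
proof (induction X rule: infinite_finite_induct)
  case (insert x X)
  then show ?case using sigma_span_add[of "F x" r m "\<lambda>j. \<Sum>x\<in>X. F x j"] by simp
qed (auto simp: sigma_span_def intro!: exI[of _ "\<lambda>_ _. 0"])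

lemma sigma_span_fibre:
  assumes "1 \<le> l" "l < 2 * r"
  shows "(\<lambda>j. of_bool (sigma r m l j = k)) \<in> sigma_span r m"
  unfolding sigma_span_def
proof (intro CollectI exI[of _ "\<lambda>l' k'. of_bool (l' = l \<and> k' = k)"] ballI)
  fix j
  have "(\<Sum>l'\<in>{1..<2 * r}. of_bool (l' = l \<and> sigma r m l' j = k))
     = (\<Sum>l'\<in>{1..<2 * r}. if l' = l then of_bool (sigma r m l j = k) else (0::real))"
    by (intro sum.cong) auto
  then show "of_bool (sigma r m l j = k) = (\<Sum>l'\<in>{1..<2 * r}. of_bool (l' = l \<and> sigma r m l' j = k) :: real)"
    using assms by simp
qed

text \<open>A window of \<open>r\<close> consecutive indices is a fibre of a suitable shift, namely
  the one that moves the start of the window to a multiple of \<open>r\<close>.\<close>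

lemma sigma_span_window:
  assumes r: "r \<ge> 1" and m: "m \<ge> 2" and st: "1 \<le> st" "st + r \<le> r * m + 1"
  shows "(\<lambda>j. of_bool (st \<le> j \<and> j < st + r)) \<in> sigma_span r m"
proof -
  \<comment> \<open>The quotient \<open>(st - 1) / r\<close> rounded up. With \<open>l\<close> as
    below, the index \<open>j = st\<close> has \<open>j + l - 2 = k * r\<close>.\<close>
  define k where "k = (st - 1 + (r - 1)) div r"
  have k1: "k * r \<ge> st - 1" and k2: "k * r < st - 1 + r"
  proof -
    have eq: "st - 1 + (r - 1) = k * r + (st - 1 + (r - 1)) mod r" unfolding k_def by simp
    have "(st - 1 + (r - 1)) mod r \<le> r - 1" using r mod_less_divisor[of r "st - 1 + (r - 1)"] by linarith
    then show "k * r \<ge> st - 1" using eq by linarith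
    show "k * r < st - 1 + r" using eq r by linarith
  qed
  define l where "l = k * r - (st - 1) + 1"
  have l: "1 \<le> l" "l \<le> r" using k1 k2 r by (auto simp: l_def)
  have km: "k < m"
  proof -
    have "k * r < r * m" using k2 st by linarith
    then show ?thesis using r by (simp add: mult.commute)
  qed
  show ?thesis
  proof (rule sigma_span_cong[OF sigma_span_fibre[of l r m "k + 1"]])
    show "1 \<le> l" "l < 2 * r" using l r by auto
    fix j assume j: "j \<in> {1..r * m}"
    have "sigma r m l j = ((j + l - 2) div r) mod m + 1"
      using l r m j by (simp add: sigma_eq)
    moreover have "((j + l - 2) div r) mod m = k \<longleftrightarrow> st \<le> j \<and> j < st + r"
    proof
      assume "st \<le> j \<and> j < st + r"
      then have "j + l - 2 = k * r + (j - st)" "j - st < r" using k1 st by (auto simp: l_def)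
      then show "((j + l - 2) div r) mod m = k" using r km by simp
    next
      assume eq: "((j + l - 2) div r) mod m = k"
      define Q where "Q = (j + l - 2) div r"
      have j2: "j + l - 2 + st = k * r + j" using k1 st j by (auto simp: l_def)
      have Q1: "Q * r \<le> j + l - 2" unfolding Q_def by simp
      have Q2: "j + l - 2 < Q * r + r" unfolding Q_def using r
        by (metis add.commute dividend_less_div_times less_le_trans less_one)
      \<comment> \<open>No wrap-around: the next cyclic occurrence of the value starts
        \<open>r * m\<close> after \<open>st\<close>, hence beyond the range of
        \<open>j\<close>.\<close>
      have "Q < k + m"
      proof (rule ccontr)
        assume "\<not> Q < k + m"
        then have "(k + m) * r \<le> Q * r" by (intro mult_le_mono1) simp
        then have "k * r + r * m \<le> j + l - 2" using Q1 by (simp add: algebra_simps)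
        then show False using j2 j st by auto
      qed
      moreover have "Q mod m = k" using eq by (simp add: Q_def)
      ultimately have "Q = k"
      proof -
        have Qd: "Q = Q div m * m + k" using \<open>Q mod m = k\<close> by (metis div_mult_mod_eq)
        have "Q div m = 0"
        proof (rule ccontr)
          assume "Q div m \<noteq> 0"
          then have "1 * m \<le> Q div m * m" by (intro mult_le_mono1) simp
          then show False using Qd \<open>Q < k + m\<close> by linarith
        qed
        then show ?thesis using Qd by simp
      qed
      then have "k * r \<le> j + l - 2" "j + l - 2 < k * r + r" using Q1 Q2 by simp_all
      then show "st \<le> j \<and> j < st + r" using j2 by linarith
    qed
    ultimately show "of_bool (st \<le> j \<and> j < st + r) = (of_bool (sigma r m l j = k + 1) :: real)" by simp
  qed
qed

text \<open>Sliding a window by one step shows that the indicators of \<open>j\<close> and \<open>j + r\<close> agree modulo the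
  span, and the transpositions link \<open>2, \<dots>, r\<close> to \<open>r + 1\<close>; so all indicators are congruent, and the
  window \<open>1, \<dots>, r\<close> is congruent to \<open>r\<close> times any of them.\<close>

lemma sigma_span_UNIV:
  assumes r: "r \<ge> 1" and m: "m \<ge> 2"
  shows "U \<in> sigma_span r m"
proof -
  define e where "e = (\<lambda>(a::nat) j. of_bool (j = a) :: real)"
  have rm: "2 * r \<le> r * m" using m by simp
  then have r1: "r + 1 \<le> r * m" using r by linarith
  have step: "(\<lambda>j. e (st + r) j - e st j) \<in> sigma_span r m" if "1 \<le> st" "st + r \<le> r * m" for st
  proof -
    have "(\<lambda>j. of_bool (st + 1 \<le> j \<and> j < st + 1 + r) - of_bool (st \<le> j \<and> j < st + r)) \<in> sigma_span r m"
      using that by (intro sigma_span_diff sigma_span_window r m) auto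
    then show ?thesis by (rule sigma_span_cong) (use r in \<open>auto simp: e_def\<close>)
  qed
  have swap: "(\<lambda>j. e (r + 1) j - e p j) \<in> sigma_span r m" if p: "2 \<le> p" "p \<le> r" for p
  proof -
    \<comment> \<open>The fibre over \<open>1\<close> of this map is the window
      \<open>1, ..., r\<close> with \<open>p\<close> exchanged for \<open>r + 1\<close>; removing
      the window leaves the difference of two point indicators.\<close>
    have "(\<lambda>j. of_bool (sigma r m (2 * r + 1 - p) j = 1) - of_bool (1 \<le> j \<and> j < 1 + r)) \<in> sigma_span r m"
      using p rm by (intro sigma_span_diff sigma_span_fibre sigma_span_window r m) auto
    then show ?thesis
    proof (rule sigma_span_cong)
      fix j assume j: "j \<in> {1..r * m}"
      let ?\<tau> = "Transposition.transpose p (r + 1)"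
      have \<tau>: "1 \<le> ?\<tau> j" "?\<tau> j \<le> r * m" using j p r1 by (auto simp: Transposition.transpose_def)
      have p': "2 * r + 1 - (2 * r + 1 - p) = p" using p by simp
      have "sigma r m (2 * r + 1 - p) j = ((?\<tau> j - 1) div r) mod m + 1"
        using p j m by (subst sigma_eq) (auto simp: p')
      also have "(?\<tau> j - 1) div r < m" using \<tau> r by (simp add: div_less_iff_less_mult mult.commute)
      then have "((?\<tau> j - 1) div r) mod m = (?\<tau> j - 1) div r" by simp
      finally have "sigma r m (2 * r + 1 - p) j = 1 \<longleftrightarrow> ?\<tau> j \<le> r"
        using \<tau> r by (auto simp: div_eq_0_iff)
      then show "e (r + 1) j - e p j = of_bool (sigma r m (2 * r + 1 - p) j = 1) - of_bool (1 \<le> j \<and> j < 1 + r)"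
        using j p by (auto simp: e_def Transposition.transpose_def)
    qed
  qed
  have zero: "(\<lambda>j. 0) \<in> sigma_span r m" using sigma_span_sum[of "{}"] by simp
  have all: "(\<lambda>j. e a j - e 1 j) \<in> sigma_span r m" if "1 \<le> a" "a \<le> r * m" for a
    using that
  proof (induction a rule: less_induct)
    case (less a)
    show ?case
    proof (cases "a = 1")
      case True
      then show ?thesis using zero by simp
    next
      case a1: False
      show ?thesis
      proof (cases "a \<le> r")
        case True
        have "(\<lambda>j. (e (1 + r) j - e 1 j) - (e (r + 1) j - e a j)) \<in> sigma_span r m"
          by (rule sigma_span_diff[OF step swap]) (use a1 True less.prems r1 in auto)
        then show ?thesis by simp
      next
        case False
        then have "(\<lambda>j. (e (a - r + r) j - e (a - r) j) + (e (a - r) j - e 1 j)) \<in> sigma_span r m"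
          using less.prems r by (intro sigma_span_add[OF step less.IH]) auto
        then show ?thesis using False by simp
      qed
    qed
  qed
  have "(\<lambda>j. (1 / real r) * (of_bool (1 \<le> j \<and> j < 1 + r) - (\<Sum>a=1..r. e a j - e 1 j))) \<in> sigma_span r m"
    by (rule sigma_span_scale[OF sigma_span_diff[OF sigma_span_window[OF r m] sigma_span_sum[OF all]]]) (use r1 m in auto)
  then have e1: "e 1 \<in> sigma_span r m"
  proof (rule sigma_span_cong)
    fix j
    have "(\<Sum>a=1..r. e a j) = of_bool (1 \<le> j \<and> j < 1 + r)"
      by (auto simp: e_def of_bool_def)
    then show "e 1 j = (1 / real r) * (of_bool (1 \<le> j \<and> j < 1 + r) - (\<Sum>a=1..r. e a j - e 1 j))"
      using r by (simp add: sum_subtractf)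
  qed
  have "(\<lambda>j. \<Sum>a=1..r * m. U a * ((e a j - e 1 j) + e 1 j)) \<in> sigma_span r m"
    by (intro sigma_span_sum sigma_span_scale sigma_span_add[OF all e1]) auto
  then show ?thesis
  proof (rule sigma_span_cong)
    fix j assume "j \<in> {1..r * m}"
    moreover have "(\<Sum>a=1..r * m. U a * ((e a j - e 1 j) + e 1 j)) = (\<Sum>a=1..r * m. if a = j then U j else 0)"
      by (intro sum.cong) (auto simp: e_def)
    ultimately show "U j = (\<Sum>a=1..r * m. U a * ((e a j - e 1 j) + e 1 j))" by simp
  qed
qed

lemma length_sigma_list [simp]: "length (sigma_list r m j) = 2 * r - 1"
  by (simp add: sigma_list_def)

lemma sigma_list_nth: "b < 2 * r - 1 \<Longrightarrow> sigma_list r m j ! b = sigma r m (Suc b) j"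
  by (simp add: sigma_list_def)

text \<open>The second identity is the first one summed over \<open>j\<close>, as all fibres have
  size \<open>r\<close>. It ensures that a functional of total \<open>0\<close> on
  \<open>[r m]\<close> pulls back to one of total \<open>0\<close> on the blocks.\<close>

lemma sigma_list_representation:
  fixes U :: "nat \<Rightarrow> real"
  assumes r: "r \<ge> 1" and m: "m \<ge> 2"
  obtains y where "\<And>j. j \<in> {1..r * m} \<Longrightarrow> (\<Sum>b<2 * r - 1. y b (sigma_list r m j ! b)) = U j"
    and "real r * (\<Sum>b<2 * r - 1. \<Sum>k=1..m. y b k) = (\<Sum>j=1..r * m. U j)"
proof -
  obtain z where z: "\<And>j. j \<in> {1..r * m} \<Longrightarrow> U j = (\<Sum>l\<in>{1..<2 * r}. z l (sigma r m l j))"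
    using sigma_span_UNIV[OF assms, of U] unfolding sigma_span_def by blast
  have re: "(\<Sum>l\<in>{1..<2 * r}. F l) = (\<Sum>b<2 * r - 1. F (Suc b))" for F :: "nat \<Rightarrow> real"
    by (rule sum.reindex_bij_witness[of _ Suc "\<lambda>l. l - 1"]) auto
  have 1: "(\<Sum>b<2 * r - 1. z (Suc b) (sigma_list r m j ! b)) = U j" if "j \<in> {1..r * m}" for j
    unfolding z[OF that] re by (intro sum.cong) (auto simp: sigma_list_nth)
  have "(\<Sum>j=1..r * m. U j) = (\<Sum>j=1..r * m. \<Sum>b<2 * r - 1. z (Suc b) (sigma r m (Suc b) j))"
    by (intro sum.cong refl) (simp only: z re)
  also have "\<dots> = (\<Sum>b<2 * r - 1. \<Sum>j=1..r * m. z (Suc b) (sigma r m (Suc b) j))"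
    by (rule sum.swap)
  also have "\<dots> = (\<Sum>b<2 * r - 1. real r * (\<Sum>k=1..m. z (Suc b) k))"
    using m by (intro sum.cong refl sum_sigma) auto
  finally have "real r * (\<Sum>b<2 * r - 1. \<Sum>k=1..m. z (Suc b) k) = (\<Sum>j=1..r * m. U j)"
    by (simp add: sum_distrib_left)
  with 1 show thesis by (intro that[of "\<lambda>b. z (Suc b)"])
qed

text \<open>The identity function is a sum of functions of the single entries, so equal lists would
  force equal indices.\<close>

lemma sigma_list_separates:
  assumes r: "r \<ge> 1" and m: "m \<ge> 2" and ij: "i \<in> {1..r * m}" "j \<in> {1..r * m}" "i \<noteq> j"
  obtains b where "b < 2 * r - 1" "sigma_list r m i ! b \<noteq> sigma_list r m j ! b"
proof -
  obtain y where y: "\<And>j. j \<in> {1..r * m} \<Longrightarrow> (\<Sum>b<2 * r - 1. y b (sigma_list r m j ! b)) = real j"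
    using sigma_list_representation[OF r m, of real] by blast
  have "\<exists>b<2 * r - 1. sigma_list r m i ! b \<noteq> sigma_list r m j ! b"
  proof (rule ccontr)
    assume "\<not> ?thesis"
    then have "(\<Sum>b<2 * r - 1. y b (sigma_list r m i ! b)) = (\<Sum>b<2 * r - 1. y b (sigma_list r m j ! b))"
      by (intro sum.cong) auto
    then show False using y[OF ij(1)] y[OF ij(2)] ij(3) by simp
  qed
  then show thesis using that by blast
qed

lemma set_sigma_list:
  assumes "r \<ge> 1" "m \<ge> 1" "j \<ge> 1"
  shows "set (sigma_list r m j) \<subseteq> {1..m}"
  using assms sigma_range[of _ r m j] by (auto simp: sigma_list_def)

subsection \<open>The weights\<close>

text \<open>Triples \<open>(s - 1, s, s)\<close> have no \<open>1\<close> in the last two places, so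
  removing \<open>J_set r\<close> only truncates the other two families.\<close>

lemma W_minus_J:
  assumes "r \<ge> 1"
  shows "W_set N - J_set r = (\<lambda>s. (s, 1, s)) ` {r+1..N} \<union> (\<lambda>s. (s, s, 1)) ` {r+1..N} \<union> (\<lambda>s. (s - 1, s, s)) ` {2..N}"
proof (intro equalityI subsetI)
  fix w assume "w \<in> W_set N - J_set r"
  then obtain s where s: "s \<in> {2..N}" "w = (s, 1, s) \<or> w = (s, s, 1) \<or> w = (s - 1, s, s)"
    and nJ: "w \<notin> J_set r" by (auto simp: W_set_def)
  have "s > r" if "w = (s, 1, s) \<or> w = (s, s, 1)"
    using nJ s that by (force simp: J_set_def not_le[symmetric])
  then show "w \<in> (\<lambda>s. (s, 1, s)) ` {r+1..N} \<union> (\<lambda>s. (s, s, 1)) ` {r+1..N} \<union> (\<lambda>s. (s - 1, s, s)) ` {2..N}"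
    using s by auto
next
  fix w assume "w \<in> (\<lambda>s. (s, 1, s)) ` {r+1..N} \<union> (\<lambda>s. (s, s, 1)) ` {r+1..N} \<union> (\<lambda>s. (s - 1, s, s)) ` {2..N}"
  then show "w \<in> W_set N - J_set r"
    using assms by (force simp: W_set_def J_set_def)
qed

lemma sum_W_minus_J:
  fixes G :: "nat \<times> nat \<times> nat \<Rightarrow> real"
  assumes r: "r \<ge> 1"
  shows "(\<Sum>w\<in>W_set N - J_set r. G w) = (\<Sum>s=r+1..N. G (s, 1, s)) + (\<Sum>s=r+1..N. G (s, s, 1)) + (\<Sum>s=2..N. G (s - 1, s, s))"
proof -
  let ?A = "(\<lambda>s::nat. (s, 1::nat, s)) ` {r+1..N}" and ?B = "(\<lambda>s::nat. (s, s, 1::nat)) ` {r+1..N}"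
    and ?C = "(\<lambda>s::nat. (s - 1, s, s)) ` {2..N}"
  have "(\<Sum>w\<in>?A \<union> ?B \<union> ?C. G w) = sum G ?A + sum G ?B + sum G ?C"
    using r by (subst sum.union_disjoint, auto)+
  moreover have "sum G ?A = (\<Sum>s=r+1..N. G (s, 1, s))" "sum G ?B = (\<Sum>s=r+1..N. G (s, s, 1))"
    "sum G ?C = (\<Sum>s=2..N. G (s - 1, s, s))"
    by (subst sum.reindex; auto simp: inj_on_def)+
  ultimately show ?thesis unfolding W_minus_J[OF r] by simp
qed

lemma W_set_range: "(i, j, k) \<in> W_set N \<Longrightarrow> i \<in> {1..N} \<and> j \<in> {1..N} \<and> k \<in> {1..N}"
  by (auto simp: W_set_def)

lemma finite_W_set: "finite (W_set N)"
  by (simp add: W_set_def)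

text \<open>Any two coordinates determine the third within \<open>W_set N\<close>. Since the three
  coordinates occupy disjoint groups of blocks, this is the source of freeness.\<close>

lemma W_set_two_differences:
  assumes "(i, j, k) \<in> W_set N" "(i', j', k') \<in> W_set N" "(i, j, k) \<noteq> (i', j', k')"
  shows "(i \<noteq> i' \<and> j \<noteq> j') \<or> (i \<noteq> i' \<and> k \<noteq> k') \<or> (j \<noteq> j' \<and> k \<noteq> k')"
  using assms by (auto simp: W_set_def)

text \<open>The value \<open>1\<close> on all weights determines \<open>U\<close> from \<open>V\<close> and forces \<open>V\<close> to be halved at each step;
  the initial value is then fixed by the vanishing of the total sum.\<close>

lemma W_set_functional:
  assumes N: "N \<ge> 2"
  obtains U V :: "nat \<Rightarrow> real"
  where "\<And>i j k. (i, j, k) \<in> W_set N \<Longrightarrow> U i + V j + V k = 1"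
    and "(\<Sum>j=1..N. U j) + 2 * (\<Sum>j=1..N. V j) = 0"
proof -
  \<comment> \<open>The triples with a \<open>1\<close> and their successor
    \<open>(s, s + 1, s + 1)\<close> give \<open>2 * V (s + 1) = V s + V 1\<close>, whence halving
    once \<open>V 1 = 0\<close>. The scale \<open>N * 2 ^ N\<close> makes the partial sums computed
    below vanish at \<open>N\<close>.\<close>
  define V where "V s = (if s = 1 then 0 else real N * 2 ^ N / 2 ^ s)" for s :: nat
  define U where "U s = 1 - 2 * V (s + 1)" for s :: nat
  have half: "2 * V (s + 1) = V s" if "s \<ge> 2" for s
    using that by (simp add: V_def)
  have "U i + V j + V k = 1" if W: "(i, j, k) \<in> W_set N" for i j k
  proof -
    obtain s where s: "s \<in> {2..N}" "(i, j, k) \<in> {(s, 1, s), (s, s, 1), (s - 1, s, s)}"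
      using W unfolding W_set_def by blast
    then show ?thesis using half[of s] by (auto simp: U_def V_def[of "Suc 0"])
  qed
  moreover have "(\<Sum>j=1..n. U j) + 2 * (\<Sum>j=1..n. V j) = real n - real N * 2 ^ N / 2 ^ n" if "n \<ge> 1" for n
    using that
  proof (induction n rule: nat_induct_at_least)
    case base
    then show ?case by (simp add: U_def V_def)
  next
    case (Suc n)
    define c where "c = real N * 2 ^ N / 2 ^ Suc n"
    have "V (Suc n) = c" "U (Suc n) = 1 - c" "real N * 2 ^ N / 2 ^ n = 2 * c"
      using Suc.hyps by (simp_all add: U_def V_def c_def)
    then show ?case using Suc.IH unfolding c_def[symmetric] by simp
  qed
  from this[of N] N have "(\<Sum>j=1..N. U j) + 2 * (\<Sum>j=1..N. V j) = 0" by simp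
  ultimately show thesis by (rule that)
qed

text \<open>The weights \<open>X\<^sub>s\<close> on \<open>(s, 1, s)\<close> and \<open>(s, s, 1)\<close>, \<open>1 / N - X\<^sub>s\<close> on \<open>(s - 1, s, s)\<close>, with
  \<open>X\<^sub>s\<^sub>+\<^sub>1 = 2 X\<^sub>s\<close>: the marginals telescope and are uniform up to the smallest term \<open>\<xi>\<close>.\<close>

lemma W_minus_J_weights:
  assumes r: "r \<ge> 1" and N: "N > r"
  defines "\<xi> \<equiv> 2 ^ r / (2 ^ N * real N)"
  obtains lam :: "nat \<times> nat \<times> nat \<Rightarrow> real"
  where "\<And>w. w \<in> W_set N - J_set r \<Longrightarrow> lam w \<ge> 0"
    and "\<And>f. (\<Sum>(i, j, k)\<in>W_set N - J_set r. lam (i, j, k) * f i) = (\<Sum>j=1..N. f j) / real N - \<xi> * f r"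
    and "\<And>f. (\<Sum>(i, j, k)\<in>W_set N - J_set r. lam (i, j, k) * f j) = (\<Sum>j=1..N. f j) / real N - \<xi> * f 1"
    and "\<And>f. (\<Sum>(i, j, k)\<in>W_set N - J_set r. lam (i, j, k) * f k) = (\<Sum>j=1..N. f j) / real N - \<xi> * f 1"
proof -
  \<comment> \<open>Scaled so that \<open>X (N + 1) = 1 / N\<close>: the upper boundary term of the
    telescoping sum then supplies the value \<open>f N\<close> missing from the sum of
    \<open>f (s - 1)\<close>.\<close>
  define X where "X s = (2 ^ s / (2 * 2 ^ N * real N) :: real)" for s :: nat
  define x where "x s = (if s \<le> r then 0 else X s)" for s
  \<comment> \<open>An entry \<open>1\<close> among the last two tells the families apart, and
    \<open>s\<close> is read off from \<open>i\<close> or from \<open>j\<close> accordingly. Where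
    \<open>x\<close> is zero, for \<open>s \<le> r\<close>, the third family keeps the full weight
    \<open>1 / N\<close>.\<close>
  define lam where "lam = (\<lambda>(i, j :: nat, k :: nat). if j = 1 \<or> k = 1 then x i else 1 / real N - x j)"
  have N0: "real N > 0" using N by simp
  have X\<xi>: "X (r + 1) = \<xi>" using N0 by (simp add: X_def \<xi>_def)
  have XN: "X (N + 1) = 1 / real N" using N0 by (simp add: X_def)
  have X2: "X (s + 1) = 2 * X s" for s by (simp add: X_def)
  have split2: "(\<Sum>s=2..N. g s) = (\<Sum>s=1..N. g s) - g 1" for g :: "nat \<Rightarrow> real"
    using N r by (subst sum.atLeast_Suc_atMost[of 1 N]) (auto simp: numeral_2_eq_2)
  have restrict: "(\<Sum>s=2..N. x s * g s) = (\<Sum>s=r+1..N. X s * g s)" for g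
    using r by (intro sum.mono_neutral_cong_right) (auto simp: x_def)
  have restrict': "(\<Sum>s=r+1..N. x s * g s) = (\<Sum>s=r+1..N. X s * g s)" for g
    by (intro sum.cong) (auto simp: x_def)
  \<comment> \<open>Since \<open>2 * X s = X (s + 1)\<close>, consecutive terms cancel and only the
    two boundary terms survive.\<close>
  have tel: "(\<Sum>s=r+1..n. 2 * X s * f s - X s * f (s - 1)) = X (n + 1) * f n - \<xi> * f r" if "n \<ge> r" for n and f :: "nat \<Rightarrow> real"
    using that
  proof (induction n rule: nat_induct_at_least)
    case base
    then show ?case using X\<xi> by simp
  next
    case (Suc n)
    then show ?case using X2[of "Suc n"] by (simp add: algebra_simps)
  qed
  \<comment> \<open>For constant \<open>f\<close> the telescoping summand is \<open>X s\<close>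
    itself.\<close>
  have sumX: "(\<Sum>s=r+1..N. X s) = 1 / real N - \<xi>"
    using tel[of N "\<lambda>_. 1"] N XN by simp
  have total: "(\<Sum>(i, j, k)\<in>W_set N - J_set r. lam (i, j, k) * F i j k)
     = (\<Sum>s=r+1..N. X s * F s 1 s) + (\<Sum>s=r+1..N. X s * F s s 1) +
       (\<Sum>s=2..N. F (s - 1) s s) / real N - (\<Sum>s=r+1..N. X s * F (s - 1) s s)" for F :: "nat \<Rightarrow> nat \<Rightarrow> nat \<Rightarrow> real"
  proof -
    have "(\<Sum>(i, j, k)\<in>W_set N - J_set r. lam (i, j, k) * F i j k)
       = (\<Sum>s=r+1..N. x s * F s 1 s) + (\<Sum>s=r+1..N. x s * F s s 1) + (\<Sum>s=2..N. (1 / real N - x s) * F (s - 1) s s)"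
      unfolding sum_W_minus_J[OF r] lam_def
      by (intro arg_cong2[where f = "(+)"] sum.cong) auto
    also have "(\<Sum>s=2..N. (1 / real N - x s) * F (s - 1) s s)
       = (\<Sum>s=2..N. F (s - 1) s s) / real N - (\<Sum>s=2..N. x s * F (s - 1) s s)"
      by (simp add: left_diff_distrib sum_subtractf sum_divide_distrib)
    finally show ?thesis unfolding restrict restrict' by simp
  qed
  show thesis
  proof (rule that[of lam])
    fix w assume w: "w \<in> W_set N - J_set r"
    obtain i j k where ijk: "w = (i, j, k)" by (cases w)
    have "j \<le> N" using w ijk W_set_range[of i j k N] by auto
    then have "X j \<le> 1 / real N"
    proof -
      have "(2::real) ^ j \<le> 2 ^ N" using \<open>j \<le> N\<close> by (intro power_increasing) auto
      also have "\<dots> \<le> 2 * 2 ^ N" by simp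
      finally show ?thesis using N0 by (simp add: X_def field_simps)
    qed
    then show "lam w \<ge> 0" using ijk N0 by (auto simp: lam_def x_def X_def)
  next
    fix f :: "nat \<Rightarrow> real"
    have "(\<Sum>s=2..N. f (s - 1)) = (\<Sum>s=1..N. f s) - f N"
    proof -
      have "(\<Sum>s=2..N. f (s - 1)) = (\<Sum>s=1..N - 1. f s)"
        by (rule sum.reindex_bij_witness[of _ Suc "\<lambda>s. s - 1"]) auto
      moreover have "(\<Sum>s=1..N. f s) = (\<Sum>s=1..N - 1. f s) + f N"
        using N by (cases N) auto
      ultimately show ?thesis by simp
    qed
    then show "(\<Sum>(i, j, k)\<in>W_set N - J_set r. lam (i, j, k) * f i) = (\<Sum>j=1..N. f j) / real N - \<xi> * f r"
      using total[of "\<lambda>i j k. f i"] tel[of N f] N XN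
      by (simp add: sum_subtractf diff_divide_distrib sum.distrib[symmetric] flip: sum_distrib_left)
        (simp add: sum_distrib_left mult.assoc)
  next
    fix f :: "nat \<Rightarrow> real"
    have "(\<Sum>(i, j, k)\<in>W_set N - J_set r. lam (i, j, k) * f j) = (\<Sum>s=r+1..N. X s) * f 1 + (\<Sum>s=2..N. f s) / real N"
      using total[of "\<lambda>i j k. f j"] by (simp add: sum_distrib_right)
    then show "(\<Sum>(i, j, k)\<in>W_set N - J_set r. lam (i, j, k) * f j) = (\<Sum>j=1..N. f j) / real N - \<xi> * f 1"
      unfolding sumX split2 by (simp add: algebra_simps diff_divide_distrib)
    have "(\<Sum>(i, j, k)\<in>W_set N - J_set r. lam (i, j, k) * f k) = (\<Sum>s=r+1..N. X s) * f 1 + (\<Sum>s=2..N. f s) / real N"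
      using total[of "\<lambda>i j k. f k"] by (simp add: sum_distrib_right)
    then show "(\<Sum>(i, j, k)\<in>W_set N - J_set r. lam (i, j, k) * f k) = (\<Sum>j=1..N. f j) / real N - \<xi> * f 1"
      unfolding sumX split2 by (simp add: algebra_simps diff_divide_distrib)
  qed
qed

subsection \<open>The gap bound\<close>

text \<open>Appending \<open>q\<close> copies of one block does not affect freeness, instability or the size of
  the deviation from the uniform marginal; this gives all degrees from the odd multiples of \<open>3\<close>.\<close>

definition padded_tuple :: "nat \<Rightarrow> nat \<Rightarrow> nat \<Rightarrow> nat \<times> nat \<times> nat \<Rightarrow> nat list" where
  "padded_tuple r m q = (\<lambda>(i, j, k). sigma_list r m i @ sigma_list r m j @ sigma_list r m k @
     replicate q (sigma r m 1 k))"

definition Gamma_padded :: "nat \<Rightarrow> nat \<Rightarrow> nat \<Rightarrow> blockvec set" where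
  "Gamma_padded r m q = (\<lambda>w. eps_tuple m (padded_tuple r m q w)) ` (W_set (r * m) - J_set r)"

lemma Gamma_odd_eq: "Gamma_odd m r = Gamma_padded r m 0"
  unfolding Gamma_odd_def Gamma_padded_def padded_tuple_def by force

text \<open>For \<open>r = 1\<close> the only map is the identity on \<open>[m]\<close> and nothing
  is removed from \<open>W_set m\<close>.\<close>

lemma Gamma3_eq:
  assumes "m \<ge> 1"
  shows "Gamma3 m = Gamma_padded 1 m 0"
proof -
  have sl: "sigma_list 1 m j = [j]" if "j \<in> {1..m}" for j
  proof -
    have "(j - 1) mod m = j - 1" using that by (intro mod_less) auto
    then show ?thesis using that assms by (simp add: sigma_list_def sigma_eq numeral_2_eq_2 upt_rec)
  qed
  have J: "J_set 1 = {}" by (simp add: J_set_def)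
  have "eps_tuple m [i, j, k] = eps_tuple m (padded_tuple 1 m 0 (i, j, k))" if "(i, j, k) \<in> W_set m" for i j k
    using W_set_range[OF that] by (simp only: padded_tuple_def prod.case sl) simp
  then show ?thesis unfolding Gamma3_def Gamma_padded_def J by force
qed

lemma sum_lessThan_add:
  fixes F :: "nat \<Rightarrow> 'a::comm_monoid_add"
  shows "(\<Sum>b<p + q. F b) = (\<Sum>b<p. F b) + (\<Sum>b<q. F (p + b))"
  by (induction q) (auto simp: add.assoc)

context
  fixes r m q M d :: nat
  assumes r: "r \<ge> 1" and m: "m \<ge> 2" and M: "M = 2 * r - 1" and d: "d = M + (M + (M + q))"
begin

lemma padded_tuple_nth:
  shows "b < M \<Longrightarrow> padded_tuple r m q (i, j, k) ! b = sigma_list r m i ! b"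
    and "b < M \<Longrightarrow> padded_tuple r m q (i, j, k) ! (M + b) = sigma_list r m j ! b"
    and "b < M \<Longrightarrow> padded_tuple r m q (i, j, k) ! (M + (M + b)) = sigma_list r m k ! b"
    and "b < q \<Longrightarrow> padded_tuple r m q (i, j, k) ! (M + (M + (M + b))) = sigma r m 1 k"
proof -
  have len: "length (sigma_list r m l) = M" for l by (simp add: M)
  show "b < M \<Longrightarrow> padded_tuple r m q (i, j, k) ! b = sigma_list r m i ! b"
    and "b < M \<Longrightarrow> padded_tuple r m q (i, j, k) ! (M + b) = sigma_list r m j ! b"
    and "b < M \<Longrightarrow> padded_tuple r m q (i, j, k) ! (M + (M + b)) = sigma_list r m k ! b"
    and "b < q \<Longrightarrow> padded_tuple r m q (i, j, k) ! (M + (M + (M + b))) = sigma r m 1 k"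
    by (simp_all add: padded_tuple_def nth_append len del: length_sigma_list)
qed

lemma length_padded_tuple: "length (padded_tuple r m q w) = d"
  by (cases w) (simp add: padded_tuple_def M d)

lemma set_padded_tuple:
  assumes "w \<in> W_set (r * m) - J_set r"
  shows "set (padded_tuple r m q w) \<subseteq> {1..m}"
proof -
  obtain i j k where w: "w = (i, j, k)" by (cases w)
  have ijk: "i \<ge> 1" "j \<ge> 1" "k \<ge> 1" using W_set_range[of i j k "r * m"] assms w by auto
  have "set (sigma_list r m l) \<subseteq> {1..m}" if "l \<ge> 1" for l using set_sigma_list[of r m l] that r m by simp
  moreover have "sigma r m 1 k \<in> {1..m}" using sigma_range[of 1 r m k] ijk r m by simp
  ultimately show ?thesis using ijk by (auto simp: w padded_tuple_def)
qed

text \<open>A difference in one coordinate of the triples shows up in that coordinate's own group of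
  \<open>M\<close> blocks; two differing coordinates therefore give two distinct blocks.\<close>

lemma padded_tuples_far:
  assumes w: "w \<in> W_set (r * m) - J_set r" "w' \<in> W_set (r * m) - J_set r" "w \<noteq> w'"
  shows "\<exists>b c. b < d \<and> c < d \<and> b \<noteq> c \<and> padded_tuple r m q w ! b \<noteq> padded_tuple r m q w' ! b \<and>
     padded_tuple r m q w ! c \<noteq> padded_tuple r m q w' ! c"
proof -
  obtain i j k where ijk: "w = (i, j, k)" by (cases w)
  obtain i' j' k' where ijk': "w' = (i', j', k')" by (cases w')
  have rng: "i \<in> {1..r*m}" "j \<in> {1..r*m}" "k \<in> {1..r*m}" "i' \<in> {1..r*m}" "j' \<in> {1..r*m}" "k' \<in> {1..r*m}"
    using W_set_range[of i j k "r * m"] W_set_range[of i' j' k' "r * m"] w ijk ijk' by auto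
  let ?D = "\<lambda>b. padded_tuple r m q w ! b \<noteq> padded_tuple r m q w' ! b"
  have D1: "\<exists>b. b < M \<and> ?D b" if ne: "i \<noteq> i'"
  proof -
    obtain b where "b < M" "sigma_list r m i ! b \<noteq> sigma_list r m i' ! b"
      using sigma_list_separates[OF r m rng(1,4) ne] M by blast
    then show ?thesis by (intro exI[of _ b]) (simp add: ijk ijk' padded_tuple_nth)
  qed
  have D2: "\<exists>b. M \<le> b \<and> b < M + M \<and> ?D b" if ne: "j \<noteq> j'"
  proof -
    obtain b where "b < M" "sigma_list r m j ! b \<noteq> sigma_list r m j' ! b"
      using sigma_list_separates[OF r m rng(2,5) ne] M by blast
    then show ?thesis by (intro exI[of _ "M + b"]) (simp add: ijk ijk' padded_tuple_nth)
  qed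
  have D3: "\<exists>b. M + M \<le> b \<and> b < M + (M + M) \<and> ?D b" if ne: "k \<noteq> k'"
  proof -
    obtain b where "b < M" "sigma_list r m k ! b \<noteq> sigma_list r m k' ! b"
      using sigma_list_separates[OF r m rng(3,6) ne] M by blast
    then show ?thesis by (intro exI[of _ "M + (M + b)"]) (simp add: ijk ijk' padded_tuple_nth)
  qed
  have "(i \<noteq> i' \<and> j \<noteq> j') \<or> (i \<noteq> i' \<and> k \<noteq> k') \<or> (j \<noteq> j' \<and> k \<noteq> k')"
    using W_set_two_differences w ijk ijk' by blast
  then show ?thesis
  proof (elim disjE conjE)
    assume "i \<noteq> i'" "j \<noteq> j'"
    then obtain b c where "b < M" "?D b" "M \<le> c" "c < M + M" "?D c" using D1 D2 by blast
    then show ?thesis using d by (intro exI[of _ b] exI[of _ c]) auto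
  next
    assume "i \<noteq> i'" "k \<noteq> k'"
    then obtain b c where "b < M" "?D b" "M + M \<le> c" "c < M + (M + M)" "?D c" using D1 D3 by blast
    then show ?thesis using d by (intro exI[of _ b] exI[of _ c]) auto
  next
    assume "j \<noteq> j'" "k \<noteq> k'"
    then obtain b c where "b < M + M" "?D b" "M + M \<le> c" "c < M + (M + M)" "?D c" using D2 D3 by blast
    then show ?thesis using d by (intro exI[of _ b] exI[of _ c]) auto
  qed
qed

text \<open>The pullback of \<open>U\<close> is placed on the first group of blocks, that of
  \<open>V\<close> on the second and the third, and \<open>0\<close> on the padding. Up to the
  factor \<open>r\<close>, the total is the sum of \<open>U\<close> plus twice the sum of
  \<open>V\<close>, which vanishes.\<close>

lemma padded_functional:
  obtains y :: "nat \<Rightarrow> nat \<Rightarrow> real"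
  where "(\<Sum>b<d. \<Sum>k=1..m. y b k) = 0"
    and "\<And>w. w \<in> W_set (r * m) \<Longrightarrow> (\<Sum>b<d. y b (padded_tuple r m q w ! b)) = 1"
proof -
  have N: "r * m \<ge> 2" using r m mult_le_mono[of 1 r 2 m] by simp
  obtain U V :: "nat \<Rightarrow> real"
    where UV: "\<And>i j k. (i, j, k) \<in> W_set (r * m) \<Longrightarrow> U i + V j + V k = 1"
      and UV0: "(\<Sum>j=1..r * m. U j) + 2 * (\<Sum>j=1..r * m. V j) = 0"
    using W_set_functional[OF N] by blast
  obtain u where u: "\<And>j. j \<in> {1..r * m} \<Longrightarrow> (\<Sum>b<M. u b (sigma_list r m j ! b)) = U j"
    and u0: "real r * (\<Sum>b<M. \<Sum>k=1..m. u b k) = (\<Sum>j=1..r * m. U j)"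
    using sigma_list_representation[OF r m, of U] M by blast
  obtain v where v: "\<And>j. j \<in> {1..r * m} \<Longrightarrow> (\<Sum>b<M. v b (sigma_list r m j ! b)) = V j"
    and v0: "real r * (\<Sum>b<M. \<Sum>k=1..m. v b k) = (\<Sum>j=1..r * m. V j)"
    using sigma_list_representation[OF r m, of V] M by blast
  define y where "y b k = (if b < M then u b k else if b < M + M then v (b - M) k
      else if b < M + (M + M) then v (b - (M + M)) k else 0)" for b k
  have y: "b < M \<Longrightarrow> y b = u b" "b < M \<Longrightarrow> y (M + b) = v b" "b < M \<Longrightarrow> y (M + (M + b)) = v b"
    "y (M + (M + (M + b))) = (\<lambda>_. 0)" for b
    by (auto simp: y_def fun_eq_iff)
  have split: "(\<Sum>b<d. F b) = (\<Sum>b<M. F b) + (\<Sum>b<M. F (M + b)) + (\<Sum>b<M. F (M + (M + b)))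
      + (\<Sum>b<q. F (M + (M + (M + b))))" for F :: "nat \<Rightarrow> real"
    unfolding d by (simp only: sum_lessThan_add add.assoc)
  have "real r * (\<Sum>b<d. \<Sum>k=1..m. y b k)
      = real r * (\<Sum>b<M. \<Sum>k=1..m. u b k) + 2 * (real r * (\<Sum>b<M. \<Sum>k=1..m. v b k))"
    unfolding split by (simp add: y distrib_left)
  also have "\<dots> = 0" unfolding u0 v0 by (rule UV0)
  finally have "(\<Sum>b<d. \<Sum>k=1..m. y b k) = 0" using r by simp
  moreover have "(\<Sum>b<d. y b (padded_tuple r m q w ! b)) = 1" if W: "w \<in> W_set (r * m)" for w
  proof -
    obtain i j k where ijk: "w = (i, j, k)" by (cases w)
    have rng: "i \<in> {1..r*m}" "j \<in> {1..r*m}" "k \<in> {1..r*m}"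
      using W_set_range[of i j k "r * m"] W ijk by auto
    have "(\<Sum>b<d. y b (padded_tuple r m q w ! b)) = U i + V j + V k"
      unfolding split ijk u[OF rng(1), symmetric] v[OF rng(2), symmetric] v[OF rng(3), symmetric]
      by (simp add: y padded_tuple_nth)
    then show ?thesis using UV W ijk by simp
  qed
  ultimately show thesis by (rule that)
qed

lemma gap_le_dist_Gamma_padded:
  assumes "SU_invariant_inner (d * m) d ip"
  shows "gap (d * m) d ip \<le> euclid_dist_0 (convex hull (Gamma_padded r m q))"
proof -
  obtain y :: "nat \<Rightarrow> nat \<Rightarrow> real" where y0: "(\<Sum>b<d. \<Sum>k=1..m. y b k) = 0"
    and y1: "\<And>w. w \<in> W_set (r * m) \<Longrightarrow> (\<Sum>b<d. y b (padded_tuple r m q w ! b)) = 1"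
    using padded_functional by blast
  have "r * m \<ge> 2" using r m mult_le_mono[of 1 r 2 m] by simp
  then have "(1, 2, 2) \<in> W_set (r * m) - J_set r" unfolding W_minus_J[OF r] by force
  then have "W_set (r * m) - J_set r \<noteq> {}" by blast
  moreover have "d > 0" using d M r by simp
  ultimately show ?thesis
    unfolding Gamma_padded_def using m finite_W_set
    by (intro gap_le_euclid_dist_0_hull[where y = y, OF _ _ length_padded_tuple set_padded_tuple assms _ _
          padded_tuples_far y0 y1]) auto
qed

text \<open>In every block the weights have the uniform marginal except for a defect \<xi> at a
  single value, and total mass \<open>1 - \<xi>\<close>. After normalisation each block deviates
  from uniform by at most \<open>\<xi> / (1 - \<xi>)\<close> in Euclidean norm, and \<open>d\<close>
  blocks cost a factor \<open>sqrt d\<close>.\<close>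

lemma dist_Gamma_padded_le:
  defines "\<xi> \<equiv> 2 ^ r / (2 ^ (r * m) * real (r * m))"
  shows "euclid_dist_0 (convex hull (Gamma_padded r m q)) \<le> sqrt (real d) * (\<xi> / (1 - \<xi>))"
proof -
  let ?I = "W_set (r * m) - J_set r"
  have Nr: "r * m \<ge> 2 * r" using m by simp
  then have N: "r * m > r" using r by linarith
  obtain lam where lam0: "\<And>w. w \<in> ?I \<Longrightarrow> lam w \<ge> 0"
    and m1: "\<And>f. (\<Sum>(i, j, k)\<in>?I. lam (i, j, k) * f i) = (\<Sum>j=1..r * m. f j) / real (r * m) - \<xi> * f r"
    and m2: "\<And>f. (\<Sum>(i, j, k)\<in>?I. lam (i, j, k) * f j) = (\<Sum>j=1..r * m. f j) / real (r * m) - \<xi> * f 1"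
    and m3: "\<And>f. (\<Sum>(i, j, k)\<in>?I. lam (i, j, k) * f k) = (\<Sum>j=1..r * m. f j) / real (r * m) - \<xi> * f 1"
    using W_minus_J_weights[OF r N] unfolding \<xi>_def by blast
  have rm0: "real (r * m) > 0" using r m by simp
  have \<xi>: "\<xi> < 1"
  proof -
    have "(2::real) ^ r < 2 ^ (r * m)" using N by (intro power_strict_increasing) auto
    also have "\<dots> \<le> 2 ^ (r * m) * real (r * m)"
    proof -
      have "1 \<le> r * m" using Nr r by linarith
      then have "1 \<le> real (r * m)" using of_nat_mono[of 1 "r * m", where 'a = real] by (simp only: of_nat_1)
      then show ?thesis using mult_left_mono[of 1 "real (r * m)" "2 ^ (r * m)"] by simp
    qed
    finally show ?thesis using rm0 by (simp add: \<xi>_def)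
  qed
  have total: "sum lam ?I = 1 - \<xi>"
    using m1[of "\<lambda>_. 1"] r m by (simp add: case_prod_beta)
  have uniform: "(\<Sum>j=1..r * m. of_bool (sigma r m l j = k)) / real (r * m) = 1 / real m"
    if "1 \<le> l" "l < 2 * r" "k \<in> {1..m}" for l k
  proof -
    have "(\<Sum>k'=1..m. of_bool (k' = k)) = (1::real)" using that(3) by (simp add: of_bool_def)
    then show ?thesis using sum_sigma[of l r m "\<lambda>k'. of_bool (k' = k)"] that m r by simp
  qed
  \<comment> \<open>Each block, padding included, shows one of the maps applied to one coordinate of
    the triple. The defect sits at the image of \<open>r\<close> for the first coordinate and at the
    image of \<open>1\<close> for the other two.\<close>
  have marg: "\<exists>k0\<in>{1..m}. \<forall>k\<in>{1..m}. (\<Sum>w\<in>?I. lam w * of_bool (padded_tuple r m q w ! b = k))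
      = 1 / real m - \<xi> * of_bool (k0 = k)" if b: "b < d" for b
  proof -
    let ?t = "padded_tuple r m q"
    have red: "(\<Sum>w\<in>?I. lam w * of_bool (?t w ! b = k))
        = (\<Sum>(i, j, l)\<in>?I. lam (i, j, l) * of_bool (?t (i, j, l) ! b = k))" for k
      by (rule sum.cong) auto
    have "\<exists>l. 1 \<le> l \<and> l < 2 * r \<and> ((\<forall>i j k. ?t (i, j, k) ! b = sigma r m l i) \<or>
        (\<forall>i j k. ?t (i, j, k) ! b = sigma r m l j) \<or> (\<forall>i j k. ?t (i, j, k) ! b = sigma r m l k))"
    proof -
      have lt: "Suc c < 2 * r" if "c < M" for c using that M by simp
      have nth: "sigma_list r m x ! c = sigma r m (Suc c) x" if "c < M" for c x
        using that M by (simp add: sigma_list_nth)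
      consider "b < M" | c where "c < M" "b = M + c" | c where "c < M" "b = M + (M + c)"
        | c where "c < q" "b = M + (M + (M + c))"
      proof -
        assume 1: "b < M \<Longrightarrow> thesis" and 2: "\<And>c. c < M \<Longrightarrow> b = M + c \<Longrightarrow> thesis"
          and 3: "\<And>c. c < M \<Longrightarrow> b = M + (M + c) \<Longrightarrow> thesis"
          and 4: "\<And>c. c < q \<Longrightarrow> b = M + (M + (M + c)) \<Longrightarrow> thesis"
        show thesis
          using 1 2[of "b - M"] 3[of "b - (M + M)"] 4[of "b - (M + (M + M))"] b d by linarith
      qed
      then show ?thesis
      proof cases
        case 1
        then show ?thesis
          by (intro exI[of _ "Suc b"]) (simp add: padded_tuple_nth nth lt)
      next
        case 2
        then show ?thesis
          by (intro exI[of _ "Suc c"]) (simp add: padded_tuple_nth nth lt)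
      next
        case 3
        then show ?thesis
          by (intro exI[of _ "Suc c"]) (simp add: padded_tuple_nth nth lt)
      next
        case 4
        then show ?thesis
          using r by (intro exI[of _ 1]) (auto simp: padded_tuple_nth)
      qed
    qed
    then obtain l where l: "1 \<le> l" "l < 2 * r"
      and "(\<forall>i j k. ?t (i, j, k) ! b = sigma r m l i) \<or>
        (\<forall>i j k. ?t (i, j, k) ! b = sigma r m l j) \<or> (\<forall>i j k. ?t (i, j, k) ! b = sigma r m l k)"
      by blast
    from this(3) show ?thesis
    proof (elim disjE)
      assume h: "\<forall>i j k. ?t (i, j, k) ! b = sigma r m l i"
      have "sigma r m l r \<in> {1..m}" using sigma_range[OF l] r m by simp
      then show ?thesis
        unfolding red by (intro bexI[of _ "sigma r m l r"] ballI) (simp_all only: h m1 uniform[OF l])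
    next
      assume h: "\<forall>i j k. ?t (i, j, k) ! b = sigma r m l j"
      have "sigma r m l 1 \<in> {1..m}" using sigma_range[OF l] m by simp
      then show ?thesis
        unfolding red by (intro bexI[of _ "sigma r m l 1"] ballI) (simp_all only: h m2 uniform[OF l])
    next
      assume h: "\<forall>i j k. ?t (i, j, k) ! b = sigma r m l k"
      have "sigma r m l 1 \<in> {1..m}" using sigma_range[OF l] m by simp
      then show ?thesis
        unfolding red by (intro bexI[of _ "sigma r m l 1"] ballI) (simp_all only: h m3 uniform[OF l])
    qed
  qed
  define lam' where "lam' w = lam w / (1 - \<xi>)" for w
  have "euclid_dist_0 (convex hull (Gamma_padded r m q))
     \<le> sqrt (\<Sum>b<d. \<Sum>k=1..m. ((\<Sum>w\<in>?I. lam' w * of_bool (padded_tuple r m q w ! b = k)) - 1 / real m)\<^sup>2)"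
    unfolding Gamma_padded_def
  proof (rule euclid_dist_0_hull_le)
    show "lam' w \<ge> 0" if "w \<in> ?I" for w using lam0[OF that] \<xi> by (simp add: lam'_def)
    show "sum lam' ?I = 1" using total \<xi> by (simp add: lam'_def flip: sum_divide_distrib)
  qed (use m length_padded_tuple set_padded_tuple finite_W_set in auto)
  also have "\<dots> \<le> sqrt (\<Sum>b<d. (\<xi> / (1 - \<xi>))\<^sup>2)"
  proof (intro real_sqrt_le_mono sum_mono)
    fix b assume "b \<in> {..<d}"
    then obtain k0 where k0: "k0 \<in> {1..m}" and marg_k0: "\<And>k. k \<in> {1..m} \<Longrightarrow>
        (\<Sum>w\<in>?I. lam w * of_bool (padded_tuple r m q w ! b = k)) = 1 / real m - \<xi> * of_bool (k0 = k)"
      using marg by blast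
    have "(\<Sum>k=1..m. ((\<Sum>w\<in>?I. lam' w * of_bool (padded_tuple r m q w ! b = k)) - 1 / real m)\<^sup>2)
        = (\<Sum>k=1..m. (\<xi> / (1 - \<xi>))\<^sup>2 * (1 / (real m)\<^sup>2 + (1 - 2 / real m) * of_bool (k0 = k)))"
    proof (rule sum.cong[OF refl])
      fix k assume k: "k \<in> {1..m}"
      have "(\<Sum>w\<in>?I. lam' w * of_bool (padded_tuple r m q w ! b = k))
          = (1 / real m - \<xi> * of_bool (k0 = k)) / (1 - \<xi>)"
        unfolding marg_k0[OF k, symmetric] sum_divide_distrib by (simp add: lam'_def)
      also have "\<dots> = 1 / real m + (\<xi> / (1 - \<xi>)) * (1 / real m - of_bool (k0 = k))"
      proof -
        have "a - \<xi> * e = a * (1 - \<xi>) + \<xi> * (a - e)" for a e by (simp add: algebra_simps)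
        then show ?thesis using \<xi> by (simp only: add_divide_distrib) simp
      qed
      finally have "(\<Sum>w\<in>?I. lam' w * of_bool (padded_tuple r m q w ! b = k)) - 1 / real m
          = (\<xi> / (1 - \<xi>)) * (1 / real m - of_bool (k0 = k))"
        by simp
      \<comment> \<open>An indicator equals its square, so the expression is affine in it and easy
        to sum over \<open>k\<close>.\<close>
      moreover have "(1 / real m - of_bool (k0 = k))\<^sup>2 = 1 / (real m)\<^sup>2 + (1 - 2 / real m) * of_bool (k0 = k)"
        by (simp add: power2_eq_square algebra_simps)
      ultimately show "((\<Sum>w\<in>?I. lam' w * of_bool (padded_tuple r m q w ! b = k)) - 1 / real m)\<^sup>2
          = (\<xi> / (1 - \<xi>))\<^sup>2 * (1 / (real m)\<^sup>2 + (1 - 2 / real m) * of_bool (k0 = k))"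
        by (simp only: power_mult_distrib)
    qed
    also have "\<dots> = (\<xi> / (1 - \<xi>))\<^sup>2 * (\<Sum>k=1..m. 1 / (real m)\<^sup>2 + (1 - 2 / real m) * of_bool (k0 = k))"
      by (rule sum_distrib_left[symmetric])
    also have "(\<Sum>k=1..m. 1 / (real m)\<^sup>2 + (1 - 2 / real m) * of_bool (k0 = k)) = 1 - 1 / real m"
    proof -
      have "(\<Sum>k=1..m. of_bool (k0 = k)) = (1::real)" using k0 by (simp add: of_bool_def)
      then have "(\<Sum>k=1..m. 1 / (real m)\<^sup>2 + (1 - 2 / real m) * of_bool (k0 = k))
          = real m * (1 / (real m)\<^sup>2) + (1 - 2 / real m)"
        by (simp add: sum.distrib flip: sum_distrib_left)
      then show ?thesis using m by (simp add: power2_eq_square)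
    qed
    also have "(\<xi> / (1 - \<xi>))\<^sup>2 * (1 - 1 / real m) \<le> (\<xi> / (1 - \<xi>))\<^sup>2 * 1"
      by (intro mult_left_mono) auto
    finally show "(\<Sum>k=1..m. ((\<Sum>w\<in>?I. lam' w * of_bool (padded_tuple r m q w ! b = k)) - 1 / real m)\<^sup>2)
        \<le> (\<xi> / (1 - \<xi>))\<^sup>2" by simp
  qed
  also have "\<dots> = sqrt (real d) * (\<xi> / (1 - \<xi>))"
    using \<xi> rm0 by (simp add: real_sqrt_mult \<xi>_def)
  finally show ?thesis .
qed

end

section \<open>Numerical form of the bounds\<close>

lemma dist_Gamma_padded_le_powr:
  fixes r m q d :: nat
  assumes r: "r \<ge> 1" and m: "m \<ge> 2" and d: "d = 6 * r - 3 + q"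
  defines "h \<equiv> 2 powr (- real r * (real m - 1))"
  shows "euclid_dist_0 (convex hull (Gamma_padded r m q))
     \<le> sqrt (real d) * ((h / (real r * real m)) / (1 - h / (real r * real m)))"
proof -
  have "(2::real) ^ r / 2 ^ (r * m) = 2 powr (real r - real (r * m))"
    by (simp add: powr_diff powr_realpow flip: of_nat_mult)
  also have "real r - real (r * m) = - real r * (real m - 1)" by (simp add: algebra_simps)
  finally have h: "2 ^ r / (2 ^ (r * m) * real (r * m)) = h / (real r * real m)"
    by (simp add: h_def field_simps)
  have "d = (2 * r - 1) + ((2 * r - 1) + ((2 * r - 1) + q))" using d r by simp
  from dist_Gamma_padded_le[OF r m refl this] show ?thesis unfolding h .
qed

text \<open>Equivalent to comparing \<open>1.89 ^ 20\<close> with \<open>2 ^ 19\<close>. The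
  prefactor in the general bound is below \<open>1.89\<close>; an exponent strictly below
  \<open>1\<close> is needed so that \<open>K \<ge> 1\<close> leaves something over after absorbing
  it.\<close>

lemma powr_19_20_ge: "189 / 100 \<le> 2 powr (19 / 20 :: real)"
proof -
  have "(189 / 100 :: real) = ((189 / 100) ^ 20) powr (1 / 20)"
    by (simp add: powr_powr flip: powr_numeral)
  also have "\<dots> \<le> (2 ^ 19) powr (1 / 20)"
    by (intro powr_mono2) (simp_all add: power_divide)
  also have "((2::real) ^ 19) powr (1 / 20) = 2 powr (19 / 20)"
    using powr_powr[of 2 19 "1 / 20 :: real"] by simp
  finally show ?thesis .
qed

text \<open>The prefactor costs \<open>19 / 20\<close> in the exponent, and
  \<open>19 / 20 - K \<le> - K / 20\<close> as \<open>K \<ge> 1\<close>. Since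
  \<open>d * m \<le> 16 * K\<close>, the constant is \<open>1 / (16 * 20)\<close>.\<close>

lemma gap_le_exponential:
  assumes d: "d \<ge> 3" and m: "m \<ge> 2" and inv: "SU_invariant_inner (d * m) d ip"
  shows "gap (d * m) d ip \<le> 2 powr (- (1 / 320) * real d * real m)"
proof -
  \<comment> \<open>The largest \<open>r\<close> with \<open>6 * r - 3 \<le> d\<close>; at most five
    padding blocks remain.\<close>
  define r q where "r = (d + 3) div 6" and "q = d - (6 * r - 3)"
  have r: "r \<ge> 1" and dq: "d = 6 * r - 3 + q" and q: "q \<le> 5"
    using d unfolding r_def q_def by auto
  have d8: "d \<le> 8 * r" using dq q r by simp
  define K where "K = real r * (real m - 1)"
  define h where "h = 2 powr (- K)"
  have K1: "K \<ge> 1" unfolding K_def using r m mult_mono[of 1 "real r" 1 "real m - 1"] by simp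
  have h0: "h > 0" by (simp add: h_def)
  have "h \<le> 2 powr (-1)" unfolding h_def using K1 by (intro powr_mono) auto
  then have h1: "h \<le> 1 / 2" by (simp add: powr_minus)
  have rm: "real r * real m \<ge> 2 * real r" "real r \<ge> 1" using r m by auto
  then have rm2: "real r * real m \<ge> 2" by linarith
  define x where "x = h / (real r * real m)"
  have "x \<le> (1 / 2) / 2" unfolding x_def using h0 h1 rm2 by (intro frac_le) auto
  then have x1: "1 - x \<ge> 3 / 4" by simp
  have x0: "x \<ge> 0" unfolding x_def using h0 by simp
  \<comment> \<open>The number \<open>2.83\<close> is the square root of \<open>8\<close> rounded
    up; \<open>d \<le> 8 * r\<close> and \<open>r \<le> r * r\<close>.\<close>
  have sq: "sqrt (real d) \<le> 2.83 * real r"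
  proof (rule real_le_lsqrt)
    have "real d \<le> 8 * real r" using d8 by linarith
    also have "\<dots> \<le> 8 * (real r * real r)" using rm(2) by simp
    also have "\<dots> \<le> (2.83 * real r)\<^sup>2" by (simp add: power2_eq_square)
    finally show "real d \<le> (2.83 * real r)\<^sup>2" .
  qed auto
  have "d = (2 * r - 1) + ((2 * r - 1) + ((2 * r - 1) + q))" using dq r by simp
  then have "gap (d * m) d ip \<le> euclid_dist_0 (convex hull (Gamma_padded r m q))"
    by (rule gap_le_dist_Gamma_padded[OF r m refl _ inv])
  also have "\<dots> \<le> sqrt (real d) * (x / (1 - x))"
    using dist_Gamma_padded_le_powr[OF r m dq] unfolding x_def h_def K_def by simp
  also have "\<dots> \<le> (2.83 * real r) * (x / (3 / 4))"
    using sq x0 x1 by (intro mult_mono divide_left_mono divide_nonneg_nonneg) auto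
  also have "\<dots> = (2.83 * real r * 4 / 3 / (real r * real m)) * h" by (simp add: x_def)
  also have "\<dots> \<le> 189 / 100 * h"
  proof -
    have "2.83 * real r * 4 / 3 / (real r * real m) = 2.83 * 4 / 3 / real m" using r by simp
    also have "\<dots> \<le> 2.83 * 4 / 3 / 2" using m by (intro divide_left_mono) auto
    also have "\<dots> \<le> 189 / 100" by simp
    finally show ?thesis using h0 by (intro mult_right_mono) auto
  qed
  also have "\<dots> \<le> 2 powr (19 / 20) * h" using powr_19_20_ge h0 by (intro mult_right_mono) auto
  also have "\<dots> = 2 powr (19 / 20 - K)" by (simp add: h_def flip: powr_add)
  also have "\<dots> \<le> 2 powr (- (1 / 320) * real d * real m)"
  proof (rule powr_mono)
    \<comment> \<open>The bound \<open>m \<le> 2 * (m - 1)\<close> holds because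
      \<open>m \<ge> 2\<close>.\<close>
    have "real d * real m \<le> (8 * real r) * (2 * (real m - 1))"
      using d8 m by (intro mult_mono) auto
    also have "\<dots> = 16 * K" by (simp add: K_def)
    finally have "real d * real m \<le> 16 * K" .
    then show "19 / 20 - K \<le> - (1 / 320) * real d * real m" using K1 by simp
  qed simp
  finally show ?thesis .
qed

text \<open>With \<open>sqrt 3 \<le> 2\<close> and \<open>1 / (1 - x) \<le> 3 / 2\<close> the
  prefactor is \<open>3 / m\<close>, at most \<open>1\<close> for \<open>m \<ge> 3\<close>.\<close>

lemma dist_Gamma3_le:
  assumes m: "m \<ge> 3"
  shows "euclid_dist_0 (convex hull (Gamma3 m)) \<le> 2 powr (- real m + 1)"
proof -
  define h where "h = 2 powr (- real m + 1)"
  have h0: "h > 0" by (simp add: h_def)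
  have "h \<le> 2 powr 0" unfolding h_def using m by (intro powr_mono) auto
  then have h1: "h \<le> 1" by simp
  define x where "x = h / real m"
  have "x \<le> 1 / 3" unfolding x_def using h0 h1 m by (intro frac_le) auto
  then have x1: "1 - x \<ge> 2 / 3" by simp
  have x0: "x \<ge> 0" unfolding x_def using h0 by simp
  have "euclid_dist_0 (convex hull (Gamma3 m)) \<le> sqrt 3 * (x / (1 - x))"
    using dist_Gamma_padded_le_powr[of 1 m 3 0] m Gamma3_eq[of m] unfolding x_def h_def by simp
  also have "\<dots> \<le> 2 * (x / (2 / 3))"
    using x0 x1 by (intro mult_mono divide_left_mono divide_nonneg_nonneg real_le_lsqrt) auto
  also have "\<dots> = (3 / real m) * h" by (simp add: x_def)
  also have "\<dots> \<le> 1 * h" using m h0 by (intro mult_right_mono) auto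
  finally show ?thesis by (simp add: h_def)
qed

text \<open>The factor \<open>sqrt d \<le> 3 * r\<close> cancels against the \<open>r\<close> in the
  denominator of \<open>x\<close>. What remains is at most \<open>9 / (2 * m)\<close>, and bounding
  it by \<open>2\<close> accounts for the \<open>+ 1\<close> in the exponent.\<close>

lemma dist_Gamma_odd_le:
  assumes m: "m \<ge> 3" and r: "r \<ge> 1"
  shows "euclid_dist_0 (convex hull (Gamma_odd m r)) \<le> 2 powr (- real r * (real m - 1) + 1)"
proof -
  define h where "h = 2 powr (- real r * (real m - 1))"
  have h0: "h > 0" by (simp add: h_def)
  have "h \<le> 2 powr 0" unfolding h_def using m by (intro powr_mono) auto
  then have h1: "h \<le> 1" by simp
  define x where "x = h / (real r * real m)"
  have rm: "real r * real m \<ge> 3" using r m mult_mono[of 1 "real r" 3 "real m"] by simp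
  have "x \<le> 1 / 3" unfolding x_def using h0 h1 rm by (intro frac_le) auto
  then have x1: "1 - x \<ge> 2 / 3" by simp
  have x0: "x \<ge> 0" unfolding x_def using h0 by simp
  have sq: "sqrt (real (6 * r - 3)) \<le> 3 * real r"
  proof (rule real_le_lsqrt)
    have "real (6 * r - 3) \<le> 6 * (real r * 1)" by simp
    also have "\<dots> \<le> 9 * (real r * real r)" using r by (intro mult_mono) auto
    finally show "real (6 * r - 3) \<le> (3 * real r)\<^sup>2" by (simp add: power2_eq_square)
  qed auto
  have "euclid_dist_0 (convex hull (Gamma_odd m r)) \<le> sqrt (real (6 * r - 3)) * (x / (1 - x))"
    using dist_Gamma_padded_le_powr[OF r, of m "6 * r - 3" 0] m unfolding x_def h_def Gamma_odd_eq by simp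
  also have "\<dots> \<le> (3 * real r) * (x / (2 / 3))"
    using sq x0 x1 by (intro mult_mono divide_left_mono divide_nonneg_nonneg) auto
  also have "\<dots> = (9 / 2 / real m) * h" using r by (simp add: x_def)
  also have "\<dots> \<le> 2 * h" using m h0 by (intro mult_right_mono) (auto simp: field_simps)
  also have "\<dots> = 2 powr (- real r * (real m - 1) + 1)" unfolding powr_add h_def by simp
  finally show ?thesis .
qed

lemma gap_le_dist_Gamma3:
  assumes m: "m \<ge> 3" and inv: "SU_invariant_inner (3 * m) 3 ip"
  shows "gap (3 * m) 3 ip \<le> euclid_dist_0 (convex hull (Gamma3 m))"
  using gap_le_dist_Gamma_padded[of 1 m 1 3 0 ip] m inv Gamma3_eq[of m] by simp

lemma gap_le_dist_Gamma_odd: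
  assumes m: "m \<ge> 2" and r: "r \<ge> 1" and d: "d = 6 * r - 3" and inv: "SU_invariant_inner (d * m) d ip"
  shows "gap (d * m) d ip \<le> euclid_dist_0 (convex hull (Gamma_odd m r))"
proof -
  have "d = (2 * r - 1) + ((2 * r - 1) + ((2 * r - 1) + 0))" using r d by simp
  from gap_le_dist_Gamma_padded[OF r m refl this inv] show ?thesis by (simp only: Gamma_odd_eq)
qed

theorem theorem4p17:
  shows "(\<exists>C::real. C > 0 \<and>
      (\<forall>d m n :: nat. \<forall>ip. d \<ge> 3 \<and> m \<ge> 2 \<and> n = d * m \<and> SU_invariant_inner n d ip \<longrightarrow>
        gap n d ip \<le> 2 powr (- C * real d * real m) \<and>
        2 powr (- C * real d * real m) = 2 powr (- C * real n)))
    \<and> (\<forall>d m n :: nat. d = 3 \<and> m \<ge> 3 \<and> n = d * m \<longrightarrow>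
        (\<forall>ip. SU_invariant_inner n d ip \<longrightarrow>
           gap n d ip \<le> euclid_dist_0 (convex hull (Gamma3 m))) \<and>
        euclid_dist_0 (convex hull (Gamma3 m)) \<le> 2 powr (- real m + 1) \<and>
        2 powr (- real m + 1) = 2 powr (- real n / 3 + 1))
    \<and> (\<forall>d m n r :: nat. m \<ge> 3 \<and> r \<ge> 2 \<and> d = 6 * r - 3 \<and> n = d * m \<longrightarrow>
        (\<forall>ip. SU_invariant_inner n d ip \<longrightarrow>
           gap n d ip \<le> euclid_dist_0 (convex hull (Gamma_odd m r))) \<and>
        euclid_dist_0 (convex hull (Gamma_odd m r)) \<le> 2 powr (- real r * (real m - 1) + 1) \<and>
        2 powr (- real r * (real m - 1) + 1) = 2 powr (- ((real d + 3) * (real m - 1) / 6) + 1))"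
proof (intro conjI)
  show "\<exists>C::real. C > 0 \<and>
      (\<forall>d m n :: nat. \<forall>ip. d \<ge> 3 \<and> m \<ge> 2 \<and> n = d * m \<and> SU_invariant_inner n d ip \<longrightarrow>
        gap n d ip \<le> 2 powr (- C * real d * real m) \<and>
        2 powr (- C * real d * real m) = 2 powr (- C * real n))"
  proof (intro exI[of _ "1 / 320"] conjI allI impI)
    fix d m n :: nat and ip
    assume "d \<ge> 3 \<and> m \<ge> 2 \<and> n = d * m \<and> SU_invariant_inner n d ip"
    then show "gap n d ip \<le> 2 powr (- (1 / 320) * real d * real m)"
      and "2 powr (- (1 / 320) * real d * real m) = 2 powr (- (1 / 320) * real n)"
      using gap_le_exponential by (blast, simp)
  qed simp
  show "\<forall>d m n :: nat. d = 3 \<and> m \<ge> 3 \<and> n = d * m \<longrightarrow>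
        (\<forall>ip. SU_invariant_inner n d ip \<longrightarrow>
           gap n d ip \<le> euclid_dist_0 (convex hull (Gamma3 m))) \<and>
        euclid_dist_0 (convex hull (Gamma3 m)) \<le> 2 powr (- real m + 1) \<and>
        2 powr (- real m + 1) = 2 powr (- real n / 3 + 1)"
    using gap_le_dist_Gamma3 dist_Gamma3_le by simp
  show "\<forall>d m n r :: nat. m \<ge> 3 \<and> r \<ge> 2 \<and> d = 6 * r - 3 \<and> n = d * m \<longrightarrow>
        (\<forall>ip. SU_invariant_inner n d ip \<longrightarrow>
           gap n d ip \<le> euclid_dist_0 (convex hull (Gamma_odd m r))) \<and>
        euclid_dist_0 (convex hull (Gamma_odd m r)) \<le> 2 powr (- real r * (real m - 1) + 1) \<and>
        2 powr (- real r * (real m - 1) + 1) = 2 powr (- ((real d + 3) * (real m - 1) / 6) + 1)"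
  proof (intro allI impI conjI)
    fix d m n r :: nat
    assume *: "m \<ge> 3 \<and> r \<ge> 2 \<and> d = 6 * r - 3 \<and> n = d * m"
    show "gap n d ip \<le> euclid_dist_0 (convex hull (Gamma_odd m r))" if "SU_invariant_inner n d ip" for ip
      using * that gap_le_dist_Gamma_odd[of m r d ip] by simp
    show "euclid_dist_0 (convex hull (Gamma_odd m r)) \<le> 2 powr (- real r * (real m - 1) + 1)"
      using * by (intro dist_Gamma_odd_le) auto
    have "real d + 3 = 6 * real r" using * by simp
    then show "2 powr (- real r * (real m - 1) + 1) = 2 powr (- ((real d + 3) * (real m - 1) / 6) + 1)"
      by simp
  qed
qed

end
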